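(* Let $d\ge 1$ be an integer, let $a_0,\dots,a_d\in\mathbb{R}$, let $\mathrm{Poly}_d(x)=\sum_{i=0}^d a_i x^i$ (applied pointwise to signals), and put $I=\frac{d+1}{2}$. Let $f$ be the alias-free polynomial activation, which maps a discrete signal $x\in\ell^2(\mathbb{Z})$ to the discrete signal $y=f(x)$ obtained by the following steps: (1) $x_{\mathrm{up}}=\mathrm{Upsample}_{I}(x)$; (2) $y_{\mathrm{poly}}=\mathrm{Poly}_d(x_{\mathrm{up}})$; (3) $y_{\mathrm{LPF}}=\mathrm{LPF}_{1/I}(y_{\mathrm{poly}})$; (4) $y=\mathrm{Downsample}_{I}(y_{\mathrm{LPF}})$. Then $f$ is shift-equivariant with respect to the continuous domain: $f(\tau_\Delta(x))=\tau_\Delta(f(x))$ for every $x\in\ell^2(\mathbb{Z})$ and every $\Delta\in\mathbb{R}$.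
   Context: Fix a sampling period $T>0$. For $S>0$, let $B_S$ be the space of functions $z=c+z_0$ on $\mathbb{R}$ with $c\in\mathbb{R}$ and $z_0\in L^2(\mathbb{R})$ real-valued, continuous, with Fourier transform vanishing outside the frequency band $[-\frac{1}{2S},\frac1{2S}]$ (frequencies in cycles per unit, i.e. angular frequencies $|\omega|\le \pi/S$). A discrete signal $x\in\ell^2(\mathbb{Z})+\mathbb{R}\cdot 1$ (a real square-summable sequence plus a constant sequence) is, for each $S>0$, the sequence of samples $x[n]=z(nS)$ of a unique $z\in B_S$; call $z$ its reconstruction at period $S$. Fractional translation: for $\Delta\in\mathbb{R}$, $\tau_\Delta(x)[n]=z(nT+\Delta)$, where $z\in B_T$ is the reconstruction of $x$ at period $T$. Upsampling by a factor $I\ge 1$ (not necessarily an integer): $\mathrm{Upsample}_I(x)[m]=z(mT/I)$, $m\in\mathbb{Z}$, where $z$ is the reconstruction of $x$ at period $T$. Ideal low-pass filter with cutoff ratio $c\in(0,1]$: $\mathrm{LPF}_c$ fixes constant sequences and, on $\ell^2(\mathbb{Z})$, multiplies the discrete-time Fourier transform $X(\theta)=\sum_n x[n]e^{-i\theta n}$, $\theta\in[-\pi,\pi]$, by the indicator function of $\{|\theta|\le c\pi\}$. Downsampling by a factor $I\ge1$ (resampling at a sampling frequency divided by $I$): $\mathrm{Downsample}_I(y)[n]=w(nT)$, $n\in\mathbb{Z}$, where $w$ is the reconstruction of $y$ at period $T/I$. When $I$ is an integer this is $y[In]$. *)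

theory Defs
  imports "HOL-Analysis.Analysis"
begin

definition square_integrable :: "'a measure \<Rightarrow> ('a \<Rightarrow> 'b::real_normed_vector) \<Rightarrow> bool" where
  "square_integrable M f \<longleftrightarrow>
     f \<in> borel_measurable M \<and> integrable M (\<lambda>t. (norm (f t))\<^sup>2)"

(* Convergence F r --> g in L^2(M).  The nonnegative integral is used because the Bochner
   integral of a non-integrable function is 0. *)
definition tendsto_L2 ::
    "'a measure \<Rightarrow> ('r \<Rightarrow> 'a \<Rightarrow> 'b::real_normed_vector) \<Rightarrow> ('a \<Rightarrow> 'b) \<Rightarrow> 'r filter \<Rightarrow> bool" where
  "tendsto_L2 M F g \<F> \<longleftrightarrow>
     ((\<lambda>r. \<integral>\<^sup>+ t. ennreal ((norm (F r t - g t))\<^sup>2) \<partial>M) \<longlongrightarrow> 0) \<F>"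

(* g represents the Fourier transform of f in L^2(R), frequencies in cycles per unit.
   As f need not be integrable, the transform is the L^2-limit of the transforms of the
   truncations of f to [-R, R]; it is determined only almost everywhere. *)
definition has_fourier_transform :: "(real \<Rightarrow> complex) \<Rightarrow> (real \<Rightarrow> complex) \<Rightarrow> bool" where
  "has_fourier_transform f g \<longleftrightarrow>
     square_integrable lborel f \<and> square_integrable lborel g \<and>
     tendsto_L2 lborel
       (\<lambda>R \<xi>. LINT t:{-R..R}|lborel. exp (- (2 * pi * \<xi> * t) * \<i>) * f t) g at_top"

definition bandlimited :: "real \<Rightarrow> (real \<Rightarrow> real) set" where
  "bandlimited S = {z. \<exists>c z0 g. z = (\<lambda>t. c + z0 t) \<and>
     square_integrable lborel z0 \<and> continuous_on UNIV z0 \<and>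
     has_fourier_transform (\<lambda>t. complex_of_real (z0 t)) g \<and>
     (AE \<xi> in lborel. \<bar>\<xi>\<bar> > 1 / (2 * S) \<longrightarrow> g \<xi> = 0)}"

definition ell2 :: "(int \<Rightarrow> real) set" where
  "ell2 = {x. (\<lambda>n. (x n)\<^sup>2) summable_on UNIV}"

(* The defining property has a unique solution for S > 0 and x in ell2 + constants. *)
definition reconstruct :: "real \<Rightarrow> (int \<Rightarrow> real) \<Rightarrow> real \<Rightarrow> real" where
  "reconstruct S x = (THE z. z \<in> bandlimited S \<and> (\<forall>n. x n = z (real_of_int n * S)))"

definition translate :: "real \<Rightarrow> real \<Rightarrow> (int \<Rightarrow> real) \<Rightarrow> int \<Rightarrow> real" where
  "translate T \<Delta> x = (\<lambda>n. reconstruct T x (real_of_int n * T + \<Delta>))"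

definition upsample :: "real \<Rightarrow> real \<Rightarrow> (int \<Rightarrow> real) \<Rightarrow> int \<Rightarrow> real" where
  "upsample T I x = (\<lambda>m. reconstruct T x (real_of_int m * T / I))"

(* X represents the discrete-time Fourier transform of x in ell2: the series
   sum_n x[n] e^(-i theta n) is the L^2(-pi, pi)-limit of its symmetric partial sums. *)
definition has_dtft :: "(int \<Rightarrow> real) \<Rightarrow> (real \<Rightarrow> complex) \<Rightarrow> bool" where
  "has_dtft x X \<longleftrightarrow>
     x \<in> ell2 \<and> square_integrable (restrict_space lborel {-pi..pi}) X \<and>
     tendsto_L2 (restrict_space lborel {-pi..pi})
       (\<lambda>N \<theta>. \<Sum>n\<in>{- int N..int N}. complex_of_real (x n) * exp (- (\<theta> * real_of_int n) * \<i>))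
       X sequentially"

(* Defined on ell2 + constants, where the decomposition x = k + x0 is unique. *)
definition LPF :: "real \<Rightarrow> (int \<Rightarrow> real) \<Rightarrow> int \<Rightarrow> real" where
  "LPF c x = (THE y. \<exists>k x0 y0 X. x = (\<lambda>n. k + x0 n) \<and> y = (\<lambda>n. k + y0 n) \<and>
     has_dtft x0 X \<and> has_dtft y0 (\<lambda>\<theta>. indicator {\<theta>. \<bar>\<theta>\<bar> \<le> c * pi} \<theta> * X \<theta>))"

definition downsample :: "real \<Rightarrow> real \<Rightarrow> (int \<Rightarrow> real) \<Rightarrow> int \<Rightarrow> real" where
  "downsample T I y = (\<lambda>n. reconstruct (T / I) y (real_of_int n * T))"

definition poly_pointwise :: "nat \<Rightarrow> (nat \<Rightarrow> real) \<Rightarrow> (int \<Rightarrow> real) \<Rightarrow> int \<Rightarrow> real" where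
  "poly_pointwise d a x = (\<lambda>m. \<Sum>i\<le>d. a i * x m ^ i)"

definition alias_free_activation ::
    "real \<Rightarrow> nat \<Rightarrow> (nat \<Rightarrow> real) \<Rightarrow> (int \<Rightarrow> real) \<Rightarrow> int \<Rightarrow> real" where
  "alias_free_activation T d a x =
     (let I = (real d + 1) / 2;
          x_up = upsample T I x;
          y_poly = poly_pointwise d a x_up;
          y_LPF = LPF (1 / I) y_poly
      in downsample T I y_LPF)"

end

theory Submission
  imports Defs
begin

text \<open>
  A signal in \<open>ell2\<close> is the sequence of samples of \<open>invF g\<close> for a spectrum \<open>g\<close> supported in
  \<open>[-1/(2T), 1/(2T)]\<close>. A polynomial of degree \<open>d\<close> in this function has, up to its constant term,
  a spectrum \<open>h\<close> supported in \<open>[-d/(2T), d/(2T)]\<close>. Sampling at rate \<open>I/T = (d+1)/(2T)\<close> adds to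
  \<open>h\<close> its translates by nonzero multiples of \<open>(d+1)/(2T)\<close>, and these vanish on \<open>(-1/(2T), 1/(2T))\<close>, exactly
  the band kept by the filter. So the output consists of the samples of the low-pass part of \<open>h\<close>,
  and a translation by \<open>\<Delta>\<close> only multiplies \<open>g\<close> and \<open>h\<close> by the same character.

  The analytic input is completeness of the trigonometric system in \<open>L2\<close>. Parseval's identity for
  the samples at all offsets, integrated over one period, gives Plancherel's theorem, which in turn
  matches \<open>invF\<close> with the Fourier transform defined as a limit of truncated integrals.
\<close>

section \<open>Completeness of the trigonometric system\<close>

text \<open>Sampling on the finer grid does not by itself commute with a translation by \<Delta>:
  the aliased copies of the spectrum acquire a different phase from the part that they overlap.
  Equivariance rests on the filter discarding every frequency that an alias reaches. The nearest
  copies begin at (d+1)/(2T) - d/(2T) = 1/(2T), the very edge of the filter, so I = (d+1)/2 leaves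
  no margin and contact happens on a null set only. The constant term of the polynomial is not
  square-integrable and has no spectrum among functions, so constants are carried separately through
  every stage. \<open>reconstruct\<close> and \<open>LPF\<close> are definite descriptions, so each
  stage demands existence and uniqueness. Both become manageable once every signal is written as
  \<open>k + Re (invF g (of_int n * S))\<close> with \<open>g\<close> supported in a bounded
  interval: \<open>invF g\<close> is then an absolutely convergent integral, and Parseval's identity
  for the samples yields uniqueness.\<close>

lemma borel_measurable_cis[measurable (raw)]:
  assumes "f \<in> borel_measurable M"
  shows "(\<lambda>x. cis (f x)) \<in> borel_measurable M"
  by (rule borel_measurable_continuous_on[OF _ assms]) (intro continuous_intros)

lemma borel_measurable_cnj[measurable (raw)]:
  assumes "f \<in> borel_measurable M"
  shows "(\<lambda>x. cnj (f x)) \<in> borel_measurable M"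
  by (rule borel_measurable_continuous_on[OF _ assms]) (intro continuous_intros)

lemma mult_le_sum_power2:
  fixes a b :: real
  assumes "a \<ge> 0" "b \<ge> 0"
  shows "a * b \<le> a\<^sup>2 + b\<^sup>2"
  using mult_nonneg_nonneg[OF assms] sum_squares_bound[of a b] unfolding mult.assoc by linarith

text \<open>The integrals run over the whole line, without a support condition: their vanishing
  survives multiplication by polynomials in \<open>cis t\<close> already there. The restriction to
  one period is used only to pass from subsets of the circle to intervals.\<close>

definition zero_coeffs :: "(real \<Rightarrow> complex) \<Rightarrow> bool" where
  "zero_coeffs g \<longleftrightarrow> integrable lborel g \<and> (\<forall>n::int. (LINT t|lborel. g t * cis (of_int n * t)) = 0)"

lemma integrable_mult_cis:
  fixes g :: "real \<Rightarrow> complex"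
  assumes "integrable lborel g"
  shows "integrable lborel (\<lambda>t. g t * cis (a * t))"
proof (rule Bochner_Integration.integrable_bound[OF assms])
  have "g \<in> borel_measurable lborel" using assms by auto
  then show "(\<lambda>t. g t * cis (a * t)) \<in> borel_measurable lborel" by measurable
qed (simp add: norm_mult)

lemma zero_coeffs_mult_cis:
  assumes "zero_coeffs g"
  shows "zero_coeffs (\<lambda>t. c * (g t * cis (of_int m * t)))"
proof -
  have "(LINT t|lborel. c * (g t * cis (of_int m * t)) * cis (of_int n * t)) = 0" for n :: int
  proof -
    have "(\<lambda>t. c * (g t * cis (of_int m * t)) * cis (of_int n * t))
        = (\<lambda>t. c * (g t * cis (of_int (m + n) * t)))"
      by (auto simp: algebra_simps cis_mult)
    then show ?thesis
      using assms by (simp add: zero_coeffs_def del: of_int_add)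
  qed
  then show ?thesis
    using assms integrable_mult_cis[of g "of_int m"] unfolding zero_coeffs_def
    by (intro conjI allI integrable_mult_right) auto
qed

lemma zero_coeffs_add:
  assumes "zero_coeffs g" "zero_coeffs h"
  shows "zero_coeffs (\<lambda>t. g t + h t)"
  using assms integrable_mult_cis[of g] integrable_mult_cis[of h]
  unfolding zero_coeffs_def by (auto simp: distrib_right)

text \<open>On the circle a real-linear functional is a combination of cosine and sine, hence of the
  characters of index 1 and -1. This settles the linear generators of the real polynomial functions
  on the plane.\<close>

lemma bounded_linear_cis_eq:
  assumes "bounded_linear (f :: complex \<Rightarrow> real)"
  shows "complex_of_real (f (cis t))
       = (f 1 - \<i> * f \<i>) / 2 * cis (of_int 1 * t) + (f 1 + \<i> * f \<i>) / 2 * cis (of_int (-1) * t)"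
proof -
  interpret bounded_linear f by fact
  have "cis t = cos t *\<^sub>R 1 + sin t *\<^sub>R \<i>"
    by (simp add: complex_eq_iff)
  then have "f (cis t) = cos t * f 1 + sin t * f \<i>"
    by (simp add: add scaleR)
  then show ?thesis
    by (simp add: complex_eq_iff field_simps)
qed

text \<open>The statement is general in \<open>g\<close>, so that a product of polynomials is handled by applying the
  two induction hypotheses one after the other.\<close>
lemma zero_coeffs_mult_poly:
  assumes "real_polynomial_function p" "zero_coeffs g"
  shows "zero_coeffs (\<lambda>t. complex_of_real (p (cis t)) * g t)"
  using assms
proof (induction p arbitrary: g rule: real_polynomial_function.induct)
  case (linear f)
  define \<alpha> \<beta> where "\<alpha> = (f 1 - \<i> * f \<i>) / 2" and "\<beta> = (f 1 + \<i> * f \<i>) / 2"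
  have "(\<lambda>t. complex_of_real (f (cis t)) * g t)
      = (\<lambda>t. \<alpha> * (g t * cis (of_int 1 * t)) + \<beta> * (g t * cis (of_int (-1) * t)))"
    unfolding bounded_linear_cis_eq[OF linear(1)] \<alpha>_def \<beta>_def by (auto simp: algebra_simps)
  then show ?case
    by (simp only: zero_coeffs_add zero_coeffs_mult_cis linear(2))
next
  case (const c)
  then show ?case
    using zero_coeffs_mult_cis[of g c 0] by simp
next
  case (add f1 f2)
  then show ?case
    using zero_coeffs_add[OF add.IH(1)[OF add.prems] add.IH(2)[OF add.prems]]
    by (simp add: distrib_right)
next
  case (mult f1 f2)
  show ?case
    using mult.IH(1)[OF mult.IH(2)[OF mult.prems]] by (simp add: mult.assoc)
qed

text \<open>By Stone--Weierstrass on the compact unit circle, \<open>u\<close> is within any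
  \<open>e\<close> of a polynomial. The polynomial integrates to zero against \<open>g\<close>, so
  the integral is at most \<open>e\<close> times the L1 norm of \<open>g\<close>.\<close>

lemma zero_coeffs_continuous:
  fixes u :: "complex \<Rightarrow> real"
  assumes g: "zero_coeffs g" and u: "continuous_on UNIV u"
  shows "integrable lborel (\<lambda>t. complex_of_real (u (cis t)) * g t)"
    and "(LINT t|lborel. complex_of_real (u (cis t)) * g t) = 0"
proof -
  have ig: "integrable lborel g" using g by (simp add: zero_coeffs_def)
  then have gm[measurable]: "g \<in> borel_measurable borel" by auto
  have um[measurable]: "u \<in> borel_measurable borel"
    using u by (rule borel_measurable_continuous_onI)
  have cont: "continuous_on (sphere 0 1) u"
    using u continuous_on_subset by blast
  have "bounded (u ` sphere 0 1)"
    by (intro compact_imp_bounded compact_continuous_image cont compact_sphere)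
  then have "\<exists>b. \<forall>z\<in>sphere 0 1. \<bar>u z\<bar> \<le> b"
    by (auto simp: bounded_iff)
  then obtain b where b: "\<And>z. z \<in> sphere 0 1 \<Longrightarrow> \<bar>u z\<bar> \<le> b"
    by blast
  show int: "integrable lborel (\<lambda>t. complex_of_real (u (cis t)) * g t)"
  proof (rule Bochner_Integration.integrable_bound)
    show "integrable lborel (\<lambda>t. b *\<^sub>R g t)" using ig by simp
    show "AE x in lborel. norm (complex_of_real (u (cis x)) * g x) \<le> norm (b *\<^sub>R g x)"
    proof (intro AE_I2)
      fix t
      have "\<bar>u (cis t)\<bar> \<le> \<bar>b\<bar>" using b[of "cis t"] by simp
      then show "norm (complex_of_real (u (cis t)) * g t) \<le> norm (b *\<^sub>R g t)"
        by (simp add: norm_mult mult_right_mono)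
    qed
  qed simp
  let ?I = "LINT t|lborel. complex_of_real (u (cis t)) * g t"
  let ?C = "LINT t|lborel. norm (g t)"
  have small: "norm ?I \<le> e * ?C" if e: "e > 0" for e
  proof -
    obtain p where p: "real_polynomial_function p" "\<And>z. z \<in> sphere 0 1 \<Longrightarrow> \<bar>u z - p z\<bar> < e"
      using Stone_Weierstrass_real_polynomial_function[OF compact_sphere cont e] by blast
    let ?p = "\<lambda>t. complex_of_real (p (cis t)) * g t"
    have zp: "zero_coeffs ?p" by (rule zero_coeffs_mult_poly[OF p(1) g])
    then have ip: "integrable lborel ?p" and p0: "(LINT t|lborel. ?p t) = 0"
      unfolding zero_coeffs_def by (auto dest: spec[of _ 0])
    have "?I = (LINT t|lborel. complex_of_real (u (cis t)) * g t - ?p t)"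
      using int ip p0 by simp
    also have "norm \<dots> \<le> (LINT t|lborel. e * norm (g t))"
    proof (rule Bochner_Integration.integral_norm_bound_integral)
      show "norm (complex_of_real (u (cis t)) * g t - ?p t) \<le> e * norm (g t)" for t
      proof -
        have "complex_of_real (u (cis t)) * g t - ?p t = complex_of_real (u (cis t) - p (cis t)) * g t"
          by (simp add: algebra_simps)
        then show ?thesis
          using p(2)[of "cis t"] by (simp add: norm_mult mult_right_mono del: of_real_diff)
      qed
    qed (use int ip ig in auto)
    finally show ?thesis by simp
  qed
  have "norm ?I \<le> 0"
  proof (rule field_le_epsilon)
    fix e :: real assume e: "e > 0"
    have C: "?C \<ge> 0" by (intro Bochner_Integration.integral_nonneg) simp
    have le: "e / (C + 1) * C \<le> e" if "C \<ge> 0" for C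
      using that e by (simp add: field_simps)
    \<comment> \<open>Adding 1 keeps the divisor positive even when \<open>g\<close> is zero almost
      everywhere.\<close>
    have "norm ?I \<le> e / (?C + 1) * ?C" using C e by (intro small divide_pos_pos) linarith+
    also have "\<dots> \<le> 0 + e" using le[OF C] by simp
    finally show "norm ?I \<le> 0 + e" .
  qed
  then show "?I = 0" by simp
qed

text \<open>The indicator of a closed set is the pointwise limit of the continuous functions
  \<open>u k\<close>, which are 1 on \<open>K\<close> and fall to 0 within distance 1/k of it. They
  are bounded by 1, so dominated convergence applies.\<close>

lemma zero_coeffs_closed:
  assumes g: "zero_coeffs g" and K: "closed K" "K \<noteq> {}"
  shows "(LINT t|lborel. indicator K (cis t) * g t) = 0"
proof -
  define u where "u k z = max 0 (1 - real k * infdist z K)" for k and z :: complex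
  have ig: "integrable lborel g" using g by (simp add: zero_coeffs_def)
  then have gm[measurable]: "g \<in> borel_measurable borel" by auto
  have Km[measurable]: "K \<in> sets borel" using K by auto
  have cont: "continuous_on UNIV (u k)" for k
    unfolding u_def by (intro continuous_intros)
  have lim: "(\<lambda>k. u k z) \<longlonglongrightarrow> indicator K z" for z
  proof (cases "z \<in> K")
    case True
    then show ?thesis by (simp add: u_def)
  next
    case False
    then have pos: "infdist z K > 0"
      using K by (metis in_closed_iff_infdist_zero infdist_nonneg less_eq_real_def)
    obtain k0 :: nat where k0: "1 / infdist z K < real k0"
      using reals_Archimedean2 by blast
    have "\<forall>\<^sub>F k in sequentially. u k z = 0"
      using eventually_ge_at_top[of k0]
    proof eventually_elim
      case (elim k)
      have "1 < real k0 * infdist z K" using k0 pos by (simp add: field_simps)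
      also have "\<dots> \<le> real k * infdist z K" using elim pos by (intro mult_right_mono) auto
      finally show ?case by (simp add: u_def)
    qed
    then show ?thesis using False by (simp add: tendsto_eventually)
  qed
  have "(\<lambda>k. LINT t|lborel. complex_of_real (u k (cis t)) * g t)
      \<longlonglongrightarrow> (LINT t|lborel. complex_of_real (indicator K (cis t)) * g t)"
  proof (rule integral_dominated_convergence[where w = "\<lambda>t. norm (g t)"])
    show "(\<lambda>t. complex_of_real (u k (cis t)) * g t) \<in> borel_measurable lborel" for k
      using zero_coeffs_continuous(1)[OF g cont] by auto
    show "AE t in lborel. (\<lambda>k. complex_of_real (u k (cis t)) * g t)
         \<longlonglongrightarrow> complex_of_real (indicator K (cis t)) * g t"
      by (intro AE_I2 tendsto_intros lim)
    have "\<bar>u k z\<bar> \<le> 1" for k z by (auto simp: u_def infdist_nonneg)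
    then show "AE t in lborel. norm (complex_of_real (u k (cis t)) * g t) \<le> norm (g t)" for k
      by (intro AE_I2) (auto simp: norm_mult intro: mult_left_le_one_le)
  qed (use ig in \<open>auto\<close>)
  then have "(LINT t|lborel. complex_of_real (indicator K (cis t)) * g t) = 0"
    using zero_coeffs_continuous(2)[OF g cont] by (simp add: LIMSEQ_const_iff)
  also have "(\<lambda>t. complex_of_real (indicator K (cis t))) = (\<lambda>t. indicator K (cis t))"
    by (auto simp: indicator_def)
  finally show ?thesis by (auto simp: fun_eq_iff)
qed

text \<open>Away from the two points -pi and pi, which \<open>cis\<close> identifies, an interval
  inside the period is the preimage of a compact arc, and arcs are closed subsets of the
  circle.\<close>

lemma zero_coeffs_interval:
  assumes g: "zero_coeffs g" and supp: "\<And>t. \<bar>t\<bar> > pi \<Longrightarrow> g t = 0"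
  shows "(LINT t:{a..b}|lborel. g t) = 0"
proof -
  have ig: "integrable lborel g" using g by (simp add: zero_coeffs_def)
  then have gm[measurable]: "g \<in> borel_measurable borel" by auto
  define K where "K = cis ` ({a..b} \<inter> {-pi..pi})"
  have K: "closed K" unfolding K_def
    by (intro compact_imp_closed compact_continuous_image continuous_intros compact_Int) auto
  have Km[measurable]: "K \<in> sets borel" using K by auto
  \<comment> \<open>One interior point suffices: \<open>s\<close> and \<open>t\<close> then differ
    by strictly less than 2 pi.\<close>
  have inj: "t = s" if "t \<in> {-pi<..<pi}" "s \<in> {-pi..pi}" "cis t = cis s" for s t
  proof -
    have "sin t = sin s \<and> cos t = cos s"
      using that(3) by (simp add: complex_eq_iff)
    then obtain n :: int where n: "t = s + 2 * pi * n"
      using sin_cos_eq_iff by blast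
    have "\<bar>2 * pi * real_of_int n\<bar> < 2 * pi * 1"
      using n that(1,2) by auto
    then have "2 * pi * \<bar>real_of_int n\<bar> < 2 * pi * 1"
      by (simp add: abs_mult)
    then have "\<bar>real_of_int n\<bar> < 1"
      by (subst (asm) mult_less_cancel_left_pos) auto
    then show ?thesis using n by simp
  qed
  \<comment> \<open>The empty arc is treated apart because \<open>infdist\<close> to the empty set
    is 0, which would make the approximating functions constantly 1.\<close>
  have "(LINT t|lborel. indicator K (cis t) * g t) = 0"
    by (cases "K = {}") (auto simp: zero_coeffs_closed[OF g K])
  moreover have "AE t in lborel. indicator K (cis t) * g t = indicator {a..b} t *\<^sub>R g t"
  proof -
    have "AE t in lborel. t \<notin> {-pi, pi}"
      by (intro AE_not_in finite_imp_null_set_lborel) auto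
    then show ?thesis
    proof eventually_elim
      case (elim t)
      show ?case
      proof (cases "\<bar>t\<bar> > pi")
        case False
        then have t: "t \<in> {-pi<..<pi}" using elim by auto
        have "cis t \<in> K \<longleftrightarrow> t \<in> {a..b}"
        proof
          assume "cis t \<in> K"
          then obtain s where "s \<in> {a..b}" "s \<in> {-pi..pi}" "cis t = cis s"
            unfolding K_def by blast
          then show "t \<in> {a..b}" using inj[OF t] by blast
        next
          assume "t \<in> {a..b}"
          then show "cis t \<in> K" using t unfolding K_def by auto
        qed
        then show ?thesis by (auto simp: indicator_def)
      qed (simp add: supp)
    qed
  qed
  ultimately show ?thesis
    unfolding set_lebesgue_integral_def
    by (subst integral_cong_AE[symmetric]) auto
qed

text \<open>The Borel sets over which \<open>g\<close> integrates to zero form a Dynkin system;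
  complements are handled by the coefficient of index 0, which is the total integral. The system
  contains the closed intervals, which are stable under intersection and generate all Borel
  sets.\<close>

lemma zero_coeffs_imp_AE_zero:
  assumes g: "zero_coeffs g" and supp: "\<And>t. \<bar>t\<bar> > pi \<Longrightarrow> g t = 0"
  shows "AE t in lborel. g t = 0"
proof -
  have ig: "integrable lborel g" using g by (simp add: zero_coeffs_def)
  have ind: "set_integrable lborel A g" if "A \<in> sets lborel" for A
    using ig that by (simp add: set_integrable_def integrable_mult_indicator)
  have total: "(LINT t|lborel. g t) = 0"
    using g unfolding zero_coeffs_def by (auto dest: spec[of _ 0])
  have zero: "(LINT t:A|lborel. g t) = 0" if "A \<in> sets borel" for A
  proof -
    have "Int_stable (range (\<lambda>(a, b). {a..b::real}))"
      by (auto simp: Int_stable_def)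
    moreover have "range (\<lambda>(a, b). {a..b::real}) \<subseteq> Pow UNIV"
      by simp
    moreover have "A \<in> sigma_sets UNIV (range (\<lambda>(a, b). {a..b::real}))"
      using that borel_eq_atLeastAtMost[where 'a=real] by (metis sets_measure_of top_greatest Pow_UNIV)
    ultimately show ?thesis
    proof (induction rule: sigma_sets_induct_disjoint)
      case (compl A)
      then have A: "A \<in> sets lborel"
        using borel_eq_atLeastAtMost[where 'a=real] by (metis sets_measure_of sets_lborel top_greatest Pow_UNIV)
      have "(LINT t:(UNIV - A) \<union> A|lborel. g t) = (LINT t:UNIV - A|lborel. g t) + (LINT t:A|lborel. g t)"
        using A by (intro set_integral_Un ind) auto
      then show ?case using compl total by (simp add: set_lebesgue_integral_def)
    next
      case (union A)
      then have A: "A i \<in> sets lborel" for i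
        using borel_eq_atLeastAtMost[where 'a=real] by (metis sets_measure_of sets_lborel top_greatest Pow_UNIV range_subsetD)
      have "(LINT t:(\<Union>i. A i)|lborel. g t) = (\<Sum>i. (LINT t:A i|lborel. g t))"
        using A union.hyps(1) ind[of "\<Union>i. A i"]
        by (intro lebesgue_integral_countable_add) (auto simp: disjoint_family_on_def)
      then show ?case using union by simp
    next
      case (basic A)
      then obtain a b where "A = {a..b}" by auto
      then show ?case using zero_coeffs_interval[of g a b] g supp by simp
    next
      case empty
      show ?case by (simp add: set_lebesgue_integral_def)
    qed
  qed
  show ?thesis
    by (rule sigma_finite_measure.density_zero[OF lborel.sigma_finite_measure_axioms ig]) (simp add: zero)
qed

section \<open>Completeness of L2 and Fourier series\<close>

lemma tendsto_0_ennrealI: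
  fixes f :: "'a \<Rightarrow> ennreal"
  assumes "\<And>e::real. e > 0 \<Longrightarrow> \<forall>\<^sub>F x in F. f x \<le> ennreal e"
  shows "(f \<longlongrightarrow> 0) F"
proof (rule order_tendstoI)
  fix a :: ennreal assume a: "0 < a"
  then obtain r where r: "0 < r" "r < a" using dense by blast
  then have "r \<noteq> top" by auto
  then obtain e where e: "r = ennreal e" "e \<ge> 0" by (cases r) auto
  with r have "e > 0" by (cases "e = 0") auto
  then show "\<forall>\<^sub>F x in F. f x < a"
    using assms[of e] r(2) e(1) by (auto elim: eventually_mono)
qed simp

text \<open>The weights 2^k turn the bound (1/8)^k into (1/4)^k, so the weighted squares are
  summable almost everywhere. Either \<open>d k x\<close> is at most 2^-k, or 2^k times it is at
  least 1 and it is below 2^k times its square; hence the increments are absolutely summable, on a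
  measure space that may be infinite.\<close>

lemma AE_convergent_of_L2_geometric:
  fixes G :: "nat \<Rightarrow> 'a \<Rightarrow> 'b::{banach, second_countable_topology}"
  assumes [measurable]: "\<And>k. G k \<in> borel_measurable M"
    and le: "\<And>k. (\<integral>\<^sup>+x. ennreal ((norm (G (Suc k) x - G k x))\<^sup>2) \<partial>M) \<le> ennreal ((1 / 8) ^ k)"
  shows "AE x in M. convergent (\<lambda>k. G k x)"
proof -
  define d where "d k x = norm (G (Suc k) x - G k x)" for k x
  have [measurable]: "d k \<in> borel_measurable M" for k
    unfolding d_def by measurable
  have "(\<integral>\<^sup>+x. (\<Sum>k. ennreal (2 ^ k * (d k x)\<^sup>2)) \<partial>M) = (\<Sum>k. \<integral>\<^sup>+x. ennreal (2 ^ k * (d k x)\<^sup>2) \<partial>M)"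
    by (rule nn_integral_suminf) auto
  also have "\<dots> \<le> (\<Sum>k. ennreal ((1 / 4) ^ k))"
  proof (intro suminf_le)
    fix k
    have "(\<integral>\<^sup>+x. ennreal (2 ^ k * (d k x)\<^sup>2) \<partial>M) = ennreal (2 ^ k) * (\<integral>\<^sup>+x. ennreal ((d k x)\<^sup>2) \<partial>M)"
      by (subst nn_integral_cmult[symmetric]) (auto simp: ennreal_mult)
    also have "\<dots> \<le> ennreal (2 ^ k) * ennreal ((1 / 8) ^ k)"
      using le[of k] by (intro mult_left_mono) (auto simp: d_def)
    also have "\<dots> = ennreal ((1 / 4) ^ k)"
      by (simp add: ennreal_mult[symmetric] power_mult_distrib[symmetric])
    finally show "(\<integral>\<^sup>+x. ennreal (2 ^ k * (d k x)\<^sup>2) \<partial>M) \<le> ennreal ((1 / 4) ^ k)" .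
  qed auto
  also have "\<dots> < \<infinity>"
    by (simp add: suminf_ennreal2 summable_geometric)
  finally have "AE x in M. (\<Sum>k. ennreal (2 ^ k * (d k x)\<^sup>2)) \<noteq> \<infinity>"
    by (intro nn_integral_PInf_AE) auto
  then show ?thesis
  proof eventually_elim
    case (elim x)
    then have s: "summable (\<lambda>k. 2 ^ k * (d k x)\<^sup>2)"
      by (intro summable_suminf_not_top) auto
    have "summable (\<lambda>k. d k x)"
    proof (rule summable_comparison_test')
      show "summable (\<lambda>k. (1 / 2) ^ k + 2 ^ k * (d k x)\<^sup>2)"
        by (intro summable_add s summable_geometric) auto
      fix k
      have d0: "d k x \<ge> 0" by (simp add: d_def)
      show "norm (d k x) \<le> (1 / 2) ^ k + 2 ^ k * (d k x)\<^sup>2"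
      proof (cases "d k x \<le> (1 / 2) ^ k")
        case True
        then show ?thesis using d0 by (simp add: add_increasing2)
      next
        case False
        then have "1 \<le> 2 ^ k * d k x" by (simp add: power_one_over field_simps)
        then have "1 * d k x \<le> 2 ^ k * d k x * d k x" using d0 by (rule mult_right_mono)
        moreover have "0 \<le> (1 / 2 :: real) ^ k" by simp
        ultimately have "0 + d k x \<le> (1 / 2) ^ k + 2 ^ k * d k x * d k x" by (intro add_mono) auto
        then show ?thesis using d0 by (simp add: power2_eq_square mult.assoc)
      qed
    qed
    then have "summable (\<lambda>k. G (Suc k) x - G k x)"
      unfolding d_def by (rule summable_norm_cancel)
    then have "convergent (\<lambda>n. \<Sum>k<n. G (Suc k) x - G k x)"
      by (simp add: summable_iff_convergent)
    then have "convergent (\<lambda>n. G n x - G 0 x)"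
      by (simp only: sum_lessThan_telescope[of "\<lambda>k. G k x"])
    then have "convergent (\<lambda>n. G n x - G 0 x + G 0 x)"
      by (rule convergent_add[OF _ convergent_const])
    then show ?case by simp
  qed
qed

text \<open>A rapidly Cauchy subsequence converges almost everywhere, and Fatou's lemma transfers
  the Cauchy estimate of the full sequence to its pointwise limit.\<close>

lemma L2_complete:
  fixes F :: "nat \<Rightarrow> 'a \<Rightarrow> 'b::{banach, second_countable_topology}"
  assumes meas[measurable]: "\<And>n. F n \<in> borel_measurable M"
    and cauchy: "\<And>e::real. e > 0 \<Longrightarrow>
      \<exists>N. \<forall>m\<ge>N. \<forall>n\<ge>N. (\<integral>\<^sup>+x. ennreal ((norm (F m x - F n x))\<^sup>2) \<partial>M) \<le> ennreal e"
  obtains f where "f \<in> borel_measurable M" "tendsto_L2 M F f sequentially"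
proof -
  have "\<exists>N. \<forall>k. \<forall>m\<ge>N k. \<forall>n\<ge>N k. (\<integral>\<^sup>+x. ennreal ((norm (F m x - F n x))\<^sup>2) \<partial>M) \<le> ennreal ((1 / 8) ^ k)"
    by (intro choice allI cauchy) auto
  then obtain N where N: "\<And>k m n. m \<ge> N k \<Longrightarrow> n \<ge> N k \<Longrightarrow>
      (\<integral>\<^sup>+x. ennreal ((norm (F m x - F n x))\<^sup>2) \<partial>M) \<le> ennreal ((1 / 8) ^ k)"
    by blast
  \<comment> \<open>The sum dominates \<open>N k\<close> and grows with \<open>k\<close>, so that
    both \<open>r k\<close> and \<open>r (Suc k)\<close> lie beyond \<open>N k\<close>; the summand
    \<open>k\<close> makes the indices tend to infinity.\<close>
  define r where "r k = k + (\<Sum>j\<le>k. N j)" for k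
  have r1: "r k \<ge> N k" "r (Suc k) \<ge> N k" "r k \<ge> k" for k
  proof -
    have "N k \<le> (\<Sum>j\<le>k. N j)" by (rule member_le_sum) auto
    then show "r k \<ge> N k" "r (Suc k) \<ge> N k" "r k \<ge> k" by (auto simp: r_def)
  qed
  define f where "f x = lim (\<lambda>k. F (r k) x)" for x
  have fm[measurable]: "f \<in> borel_measurable M"
    unfolding f_def by measurable
  have "AE x in M. convergent (\<lambda>k. F (r k) x)"
    by (rule AE_convergent_of_L2_geometric) (auto intro: N r1)
  then have lim: "AE x in M. (\<lambda>k. F (r k) x) \<longlonglongrightarrow> f x"
    by (auto simp: f_def convergent_LIMSEQ_iff)
  have "tendsto_L2 M F f sequentially"
    unfolding tendsto_L2_def
  proof (rule tendsto_0_ennrealI)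
    fix e :: real assume "e > 0"
    then obtain N0 where N0: "\<And>m n. m \<ge> N0 \<Longrightarrow> n \<ge> N0 \<Longrightarrow>
        (\<integral>\<^sup>+x. ennreal ((norm (F m x - F n x))\<^sup>2) \<partial>M) \<le> ennreal e"
      using cauchy by blast
    show "\<forall>\<^sub>F n in sequentially. (\<integral>\<^sup>+x. ennreal ((norm (F n x - f x))\<^sup>2) \<partial>M) \<le> ennreal e"
      using eventually_ge_at_top[of N0]
    proof eventually_elim
      case (elim n)
      have "(\<integral>\<^sup>+x. ennreal ((norm (F n x - f x))\<^sup>2) \<partial>M)
          = (\<integral>\<^sup>+x. liminf (\<lambda>k. ennreal ((norm (F n x - F (r k) x))\<^sup>2)) \<partial>M)"
      proof (rule nn_integral_cong_AE, use lim in eventually_elim)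
        case (elim x)
        then have "(\<lambda>k. ennreal ((norm (F n x - F (r k) x))\<^sup>2)) \<longlonglongrightarrow> ennreal ((norm (F n x - f x))\<^sup>2)"
          by (intro tendsto_intros)
        then show ?case by (intro lim_imp_Liminf[symmetric]) auto
      qed
      also have "\<dots> \<le> liminf (\<lambda>k. \<integral>\<^sup>+x. ennreal ((norm (F n x - F (r k) x))\<^sup>2) \<partial>M)"
        by (rule nn_integral_liminf) auto
      also have "\<dots> \<le> ennreal e"
      proof (rule Liminf_le)
        show "\<forall>\<^sub>F k in sequentially. (\<integral>\<^sup>+x. ennreal ((norm (F n x - F (r k) x))\<^sup>2) \<partial>M) \<le> ennreal e"
          using eventually_ge_at_top[of N0]
          by eventually_elim (use elim r1(3) in \<open>auto intro!: N0 intro: order_trans\<close>)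
      qed simp
      finally show ?case .
    qed
  qed
  with fm show ?thesis by (rule that)
qed

text \<open>Vanishing is demanded everywhere outside the interval, not just almost everywhere, so
  supports can be handled pointwise. A bounded support makes these L2 functions integrable as well,
  and their Fourier integrals converge absolutely.\<close>

definition band :: "real \<Rightarrow> (real \<Rightarrow> complex) \<Rightarrow> bool" where
  "band A g \<longleftrightarrow> g \<in> borel_measurable borel \<and> integrable lborel (\<lambda>x. (norm (g x))\<^sup>2) \<and>
     (\<forall>x. \<bar>x\<bar> > A \<longrightarrow> g x = 0)"

definition sq_norm :: "(real \<Rightarrow> complex) \<Rightarrow> real" where
  "sq_norm g = (LINT x|lborel. (norm (g x))\<^sup>2)"

lemma band_measurable: "band A g \<Longrightarrow> g \<in> borel_measurable borel"
  and band_square_integrable: "band A g \<Longrightarrow> integrable lborel (\<lambda>x. (norm (g x))\<^sup>2)"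
  and band_zero: "band A g \<Longrightarrow> \<bar>x\<bar> > A \<Longrightarrow> g x = 0"
  by (auto simp: band_def)

lemma integrable_indicator_Icc: "integrable lborel (indicator {a..b::real} :: real \<Rightarrow> real)"
  by (simp add: integrable_indicator_iff emeasure_lborel_Icc_eq)

text \<open>On the bounded support the norm is dominated by one plus its square.\<close>

lemma band_integrable:
  assumes "band A g"
  shows "integrable lborel g"
proof (rule Bochner_Integration.integrable_bound)
  show "integrable lborel (\<lambda>x. indicator {-A..A} x + (norm (g x))\<^sup>2)"
    using band_square_integrable[OF assms] integrable_indicator_Icc by simp
  have "norm (g x) \<le> indicator {-A..A} x + (norm (g x))\<^sup>2" for x
  proof (cases "\<bar>x\<bar> > A")
    case True
    then show ?thesis by (simp add: band_zero[OF assms])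
  next
    case False
    have "0 \<le> (norm (g x) - 1 / 2)\<^sup>2" by simp
    then have "norm (g x) \<le> 1 + (norm (g x))\<^sup>2"
      by (simp add: power2_eq_square algebra_simps)
    then show ?thesis using False by (auto simp: indicator_def)
  qed
  then show "AE x in lborel. norm (g x) \<le> norm (indicator {-A..A} x + (norm (g x))\<^sup>2)"
    by (intro AE_I2) (auto simp: abs_of_nonneg add_nonneg_nonneg)
qed (use band_measurable[OF assms] in simp)

lemma band_imp_square_integrable: "band A g \<Longrightarrow> square_integrable lborel g"
  by (simp add: band_def square_integrable_def)

lemma square_integrable_mult_cnj:
  fixes f g :: "real \<Rightarrow> complex"
  assumes f: "square_integrable lborel f" and g: "square_integrable lborel g"
  shows "integrable lborel (\<lambda>x. f x * cnj (g x))"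
proof (rule Bochner_Integration.integrable_bound)
  have [measurable]: "f \<in> borel_measurable borel" "g \<in> borel_measurable borel"
    using assms by (auto simp: square_integrable_def)
  show "(\<lambda>x. f x * cnj (g x)) \<in> borel_measurable lborel" by simp
  show "integrable lborel (\<lambda>x. (norm (f x))\<^sup>2 + (norm (g x))\<^sup>2)"
    using assms by (auto simp: square_integrable_def)
  have "norm (f x) * norm (g x) \<le> (norm (f x))\<^sup>2 + (norm (g x))\<^sup>2" for x
    by (rule mult_le_sum_power2) auto
  then show "AE x in lborel. norm (f x * cnj (g x)) \<le> norm ((norm (f x))\<^sup>2 + (norm (g x))\<^sup>2)"
    by (intro AE_I2) (simp add: norm_mult)
qed

lemma norm_diff_square:
  "(norm (z - w))\<^sup>2 = (norm z)\<^sup>2 + (norm w)\<^sup>2 - 2 * Re (z * cnj w)" for z w :: complex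
  unfolding cmod_power2 by (simp add: power2_eq_square algebra_simps)

lemma square_integrable_diff:
  fixes f g :: "real \<Rightarrow> complex"
  assumes f: "square_integrable lborel f" and g: "square_integrable lborel g"
  shows "square_integrable lborel (\<lambda>x. f x - g x)"
proof -
  have "integrable lborel (\<lambda>x. (norm (f x - g x))\<^sup>2)"
    unfolding norm_diff_square
    using assms square_integrable_mult_cnj[OF f g]
    by (intro Bochner_Integration.integrable_diff Bochner_Integration.integrable_add
        integrable_mult_right integrable_Re) (auto simp: square_integrable_def)
  then show ?thesis
    using assms by (auto simp: square_integrable_def intro: borel_measurable_diff)
qed

lemma band_diff:
  assumes f: "band A f" and g: "band A g"
  shows "band A (\<lambda>x. f x - g x)"
  using assms square_integrable_diff[OF assms[THEN band_imp_square_integrable]]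
  by (simp add: band_def square_integrable_def)

lemma sq_norm_diff:
  assumes f: "square_integrable lborel f" and g: "square_integrable lborel g"
  shows "sq_norm (\<lambda>x. f x - g x) = sq_norm f + sq_norm g - 2 * Re (LINT x|lborel. f x * cnj (g x))"
  unfolding sq_norm_def norm_diff_square
  using assms square_integrable_mult_cnj[OF f g]
  by (simp add: square_integrable_def integrable_Re integral_Re del: times_complex.simps)

lemma sq_norm_nonneg: "sq_norm f \<ge> 0"
  by (simp add: sq_norm_def)

lemma sq_norm_eq_0:
  assumes "band A f"
  shows "sq_norm f = 0 \<longleftrightarrow> (AE x in lborel. f x = 0)"
  unfolding sq_norm_def
  by (subst integral_nonneg_eq_0_iff_AE) (auto simp: band_square_integrable[OF assms])

lemma nn_integral_eq_sq_norm:
  assumes "square_integrable lborel f"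
  shows "(\<integral>\<^sup>+x. ennreal ((norm (f x))\<^sup>2) \<partial>lborel) = ennreal (sq_norm f)"
  unfolding sq_norm_def
  by (rule nn_integral_eq_integral) (use assms in \<open>auto simp: square_integrable_def\<close>)

lemma band_cmult:
  assumes "band A g"
  shows "band A (\<lambda>x. c * g x)"
  using assms by (auto simp: band_def norm_mult power_mult_distrib)

lemma band_uminus:
  assumes "band A g"
  shows "band A (\<lambda>x. - g x)"
  using band_cmult[OF assms, of "-1"] by simp

lemma band_add:
  assumes "band A f" "band A g"
  shows "band A (\<lambda>x. f x + g x)"
  using band_diff[OF assms(1) band_uminus[OF assms(2)]] by simp

lemma band_null: "band A (\<lambda>x. 0)"
  by (simp add: band_def)

lemma band_sum: "(\<And>i. i \<in> J \<Longrightarrow> band A (f i)) \<Longrightarrow> band A (\<lambda>x. \<Sum>i\<in>J. f i x)"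
  by (induction J rule: infinite_finite_induct) (auto intro: band_add band_null)

lemma band_mult_bounded:
  assumes g: "band A g" and [measurable]: "u \<in> borel_measurable borel" and u: "\<And>x. norm (u x) \<le> 1"
  shows "band A (\<lambda>x. u x * g x)"
proof -
  have [measurable]: "g \<in> borel_measurable borel" by (rule band_measurable[OF g])
  have "integrable lborel (\<lambda>x. (norm (u x * g x))\<^sup>2)"
  proof (rule Bochner_Integration.integrable_bound[OF band_square_integrable[OF g]])
    have "norm (u x * g x) \<le> norm (g x)" for x
      unfolding norm_mult by (intro mult_left_le_one_le) (auto simp: u)
    then show "AE x in lborel. norm ((norm (u x * g x))\<^sup>2) \<le> norm ((norm (g x))\<^sup>2)"
      by (intro AE_I2) (simp add: power_mono)
  qed simp
  then show ?thesis using g by (simp add: band_def)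
qed

lemma band_cong_support:
  assumes "band A g" "\<And>x. \<bar>x\<bar> > B \<Longrightarrow> g x = 0"
  shows "band B g"
  using assms by (simp add: band_def)

lemma band_mono: "band A g \<Longrightarrow> A \<le> B \<Longrightarrow> band B g"
  by (auto simp: band_def)

section \<open>Fourier coefficients and trigonometric sums on [-pi, pi]\<close>

lemma integral_cis_period:
  "(LINT x|lborel. indicator {-pi..pi} x * cis (of_int n * x)) = (if n = 0 then 2 * pi else 0)"
proof -
  have "(LINT x|lborel. indicator {-pi..pi} x *\<^sub>R cis (of_int n * x)) = (if n = 0 then 2 * pi else 0)"
  proof (cases "n = 0")
    case False
    have "(LINT x|lborel. indicator {-pi..pi} x *\<^sub>R cis (of_int n * x))
        = cis (of_int n * pi) / (\<i> * of_int n) - cis (of_int n * - pi) / (\<i> * of_int n)"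
    proof (rule integral_FTC_Icc)
      show "((\<lambda>x. cis (of_int n * x) / (\<i> * of_int n)) has_vector_derivative cis (of_int n * x))
              (at x within {-pi..pi})" for x
      proof -
        have "((\<lambda>z. exp (\<i> * of_int n * z) / (\<i> * of_int n)) has_field_derivative
            exp (\<i> * of_int n * of_real x)) (at (of_real x))"
          using False by (auto intro!: derivative_eq_intros)
        from has_vector_derivative_real_field[OF this] show ?thesis
          by (simp add: cis_conv_exp mult_ac)
      qed
    qed (auto intro!: continuous_intros)
    also have "\<dots> = 0"
    proof -
      have "cis (of_int n * pi) = cis (of_int n * - pi)"
        by (simp add: complex_eq_iff sin_times_pi_eq_0)
      then show ?thesis by simp
    qed
    finally show ?thesis using False by simp
  qed (simp add: scaleR_conv_of_real)
  moreover have "(\<lambda>x. indicator {-pi..pi} x *\<^sub>R cis (of_int n * x)) = (\<lambda>x. indicator {-pi..pi} x * cis (of_int n * x))"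
    by (auto simp: indicator_def)
  ultimately show ?thesis by simp
qed

text \<open>The signs follow the discrete-time Fourier transform: synthesis in \<open>fsum\<close>
  uses exp(-i n x) as in \<open>has_dtft\<close>, so \<open>fcoeff\<close> is the inverse transform,
  which recovers the sequence.\<close>

definition fcoeff :: "(real \<Rightarrow> complex) \<Rightarrow> int \<Rightarrow> complex" where
  "fcoeff g n = (LINT x|lborel. g x * cis (of_int n * x)) / (2 * pi)"

definition fsum :: "int set \<Rightarrow> (int \<Rightarrow> complex) \<Rightarrow> real \<Rightarrow> complex" where
  "fsum J c x = indicator {-pi..pi} x * (\<Sum>n\<in>J. c n * cis (- (of_int n * x)))"

lemma band_indicator: "band A (indicator {-A..A})"
proof -
  have "(\<lambda>x. (norm (indicator {-A..A} x :: complex))\<^sup>2) = indicator {-A..A}"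
    by (auto simp: indicator_def)
  moreover have "indicator {-A..A} x = (0::complex)" if "\<bar>x\<bar> > A" for x
    using that by (auto simp: indicator_def)
  ultimately show ?thesis by (simp add: band_def integrable_indicator_Icc)
qed

lemma band_fsum: "band pi (fsum J c)"
proof -
  have "band pi (\<lambda>x. c n * (cis (- (of_int n * x)) * indicator {-pi..pi} x))" for n
    by (intro band_cmult band_mult_bounded band_indicator) auto
  then have "band pi (\<lambda>x. \<Sum>n\<in>J. c n * (cis (- (of_int n * x)) * indicator {-pi..pi} x))"
    by (intro band_sum)
  then show ?thesis
    by (simp add: fsum_def[abs_def] sum_distrib_left mult_ac)
qed

lemma integral_mult_cnj_fsum:
  assumes "band pi f"
  shows "(LINT x|lborel. f x * cnj (fsum J c x)) = 2 * pi * (\<Sum>n\<in>J. cnj (c n) * fcoeff f n)"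
proof -
  have "(\<lambda>x. f x * cnj (fsum J c x)) = (\<lambda>x. \<Sum>n\<in>J. cnj (c n) * (f x * cis (of_int n * x)))"
  proof
    fix x
    show "f x * cnj (fsum J c x) = (\<Sum>n\<in>J. cnj (c n) * (f x * cis (of_int n * x)))"
    proof (cases "\<bar>x\<bar> > pi")
      case True
      then show ?thesis by (simp add: band_zero[OF assms])
    next
      case False
      then have "x \<in> {-pi..pi}" by auto
      then show ?thesis by (simp add: fsum_def sum_distrib_left cis_cnj[symmetric] mult_ac)
    qed
  qed
  then show ?thesis
    using integrable_mult_cis[OF band_integrable[OF assms]]
    by (simp add: fcoeff_def sum_distrib_left)
qed

lemma fcoeff_fsum:
  assumes "finite J"
  shows "fcoeff (fsum J c) n = (if n \<in> J then c n else 0)"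
proof -
  have int: "integrable lborel (\<lambda>x. indicator {-pi..pi} x * cis (of_int m * x))" for m
    using integrable_mult_cis[OF band_integrable[OF band_indicator]] by blast
  have "(\<lambda>x. fsum J c x * cis (of_int n * x))
      = (\<lambda>x. \<Sum>m\<in>J. c m * (indicator {-pi..pi} x * cis (of_int (n - m) * x)))"
    by (auto simp: fsum_def sum_distrib_left sum_distrib_right cis_mult algebra_simps intro!: sum.cong)
  then have "(LINT x|lborel. fsum J c x * cis (of_int n * x)) = (\<Sum>m\<in>J. c m * (if n - m = 0 then 2 * pi else 0))"
    using int by (simp add: integral_cis_period del: of_int_diff)
  also have "\<dots> = (\<Sum>m\<in>J. if n = m then 2 * pi * c n else 0)"
    by (auto intro!: sum.cong)
  also have "\<dots> = (if n \<in> J then 2 * pi * c n else 0)"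
    using assms by simp
  finally show ?thesis by (simp add: fcoeff_def)
qed

lemma sq_norm_fsum:
  assumes "finite J"
  shows "sq_norm (fsum J c) = 2 * pi * (\<Sum>n\<in>J. (norm (c n))\<^sup>2)"
proof -
  have "complex_of_real (sq_norm (fsum J c)) = (LINT x|lborel. fsum J c x * cnj (fsum J c x))"
    unfolding sq_norm_def by (simp add: complex_norm_square[symmetric] flip: integral_of_real of_real_power)
  also have "\<dots> = 2 * pi * (\<Sum>n\<in>J. cnj (c n) * c n)"
    using assms by (simp add: integral_mult_cnj_fsum[OF band_fsum] fcoeff_fsum)
  also have "\<dots> = complex_of_real (2 * pi * (\<Sum>n\<in>J. (norm (c n))\<^sup>2))"
    by (simp add: complex_norm_square[symmetric] mult.commute[of "cnj _"])
  finally show ?thesis by (simp only: of_real_eq_iff)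
qed

lemma bessel_identity:
  assumes f: "band pi f" and J: "finite J"
  shows "sq_norm (\<lambda>x. f x - fsum J (fcoeff f) x) = sq_norm f - 2 * pi * (\<Sum>n\<in>J. (norm (fcoeff f n))\<^sup>2)"
proof -
  have "(LINT x|lborel. f x * cnj (fsum J (fcoeff f) x)) = complex_of_real (2 * pi * (\<Sum>n\<in>J. (norm (fcoeff f n))\<^sup>2))"
    by (simp add: integral_mult_cnj_fsum[OF f] complex_norm_square[symmetric] mult.commute[of "cnj _"])
  then show ?thesis
    by (simp add: sq_norm_diff[OF f[THEN band_imp_square_integrable] band_fsum[THEN band_imp_square_integrable]] sq_norm_fsum[OF J] del: of_real_sum of_real_mult)
qed


lemma sq_norm_minus_commute: "sq_norm (\<lambda>x. f x - g x) = sq_norm (\<lambda>x. g x - f x)"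
  by (simp add: sq_norm_def norm_minus_commute)

text \<open>Cauchy--Schwarz against \<open>1\<close>: the variance of \<open>norm f\<close> on \<open>[-pi, pi]\<close> is nonnegative.\<close>
lemma norm_fcoeff_square_le:
  assumes f: "band pi f"
  shows "2 * pi * (norm (fcoeff f n))\<^sup>2 \<le> sq_norm f"
proof -
  define m where "m = (LINT x|lborel. norm (f x)) / (2 * pi)"
  have I: "(LINT x|lborel. norm (f x)) = 2 * pi * m" by (simp add: m_def)
  have m0: "m \<ge> 0" by (simp add: m_def)
  have "norm (LINT x|lborel. f x * cis (of_int n * x)) \<le> (LINT x|lborel. norm (f x * cis (of_int n * x)))"
    by simp
  then have "norm (fcoeff f n) \<le> m"
    by (simp add: fcoeff_def m_def norm_divide norm_mult divide_right_mono)
  then have le: "(norm (fcoeff f n))\<^sup>2 \<le> m\<^sup>2"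
    by (intro power_mono) auto
  have int: "integrable lborel (\<lambda>x. (norm (f x))\<^sup>2 - 2 * m * norm (f x))"
    using band_square_integrable[OF f] band_integrable[OF f] by (intro Bochner_Integration.integrable_diff) auto
  have int2: "integrable lborel (\<lambda>x. m\<^sup>2 * indicator {-pi..pi} x)"
    using integrable_indicator_Icc by (rule integrable_mult_right)
  have "0 \<le> (LINT x|lborel. ((norm (f x))\<^sup>2 - 2 * m * norm (f x)) + m\<^sup>2 * indicator {-pi..pi} x)"
  proof (rule Bochner_Integration.integral_nonneg)
    fix x
    show "0 \<le> ((norm (f x))\<^sup>2 - 2 * m * norm (f x)) + m\<^sup>2 * indicator {-pi..pi} x"
    proof (cases "\<bar>x\<bar> > pi")
      case True
      then show ?thesis by (simp add: band_zero[OF f])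
    next
      case False
      then have "x \<in> {-pi..pi}" by auto
      then show ?thesis
        using zero_le_power2[of "norm (f x) - m"] by (simp add: power2_diff mult_ac)
    qed
  qed
  also have "\<dots> = (LINT x|lborel. (norm (f x))\<^sup>2 - 2 * m * norm (f x)) + (LINT x|lborel. m\<^sup>2 * indicator {-pi..pi} x)"
    by (rule Bochner_Integration.integral_add[OF int int2])
  also have "(LINT x|lborel. (norm (f x))\<^sup>2 - 2 * m * norm (f x)) = sq_norm f - 2 * m * (2 * pi * m)"
    using band_square_integrable[OF f] band_integrable[OF f]
    by (subst Bochner_Integration.integral_diff) (auto simp: sq_norm_def I)
  also have "(LINT x|lborel. m\<^sup>2 * indicator {-pi..pi} x) = 2 * pi * m\<^sup>2"
    by simp
  finally have "2 * pi * m\<^sup>2 \<le> sq_norm f"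
    by (simp add: power2_eq_square algebra_simps)
  with le show ?thesis
    by (meson mult_left_mono order_trans pi_ge_zero mult_nonneg_nonneg zero_le_numeral)
qed

lemma fcoeff_diff:
  assumes "band pi f" "band pi g"
  shows "fcoeff (\<lambda>x. f x - g x) n = fcoeff f n - fcoeff g n"
  using assms[THEN band_integrable, THEN integrable_mult_cis]
  by (simp add: fcoeff_def left_diff_distrib diff_divide_distrib)

lemma fcoeff_cong_AE:
  assumes "AE x in lborel. f x = g x" and [measurable]: "f \<in> borel_measurable borel" "g \<in> borel_measurable borel"
  shows "fcoeff f n = fcoeff g n"
proof -
  have "(LINT x|lborel. f x * cis (of_int n * x)) = (LINT x|lborel. g x * cis (of_int n * x))"
    using assms(1) by (intro integral_cong_AE) auto
  then show ?thesis by (simp add: fcoeff_def)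
qed

text \<open>Cutting the limit off outside [-A, A] cannot increase its distance to the
  \<open>F n\<close>, which vanish there. The limit is square-integrable because it is one
  \<open>F n\<close> minus a difference of finite norm.\<close>

lemma band_of_L2_limit:
  assumes F: "\<And>n. band A (F n)" and f: "f \<in> borel_measurable lborel" and lim: "tendsto_L2 lborel F f sequentially"
  obtains g where "band A g" "(\<lambda>n. sq_norm (\<lambda>x. F n x - g x)) \<longlonglongrightarrow> 0"
proof -
  define g where "g x = indicator {-A..A} x * f x" for x
  have [measurable]: "f \<in> borel_measurable borel" using f by simp
  have gm[measurable]: "g \<in> borel_measurable borel" unfolding g_def by measurable
  have Fm[measurable]: "F n \<in> borel_measurable borel" for n by (rule band_measurable[OF F])
  have g0: "g x = 0" if "\<bar>x\<bar> > A" for x using that by (auto simp: g_def indicator_def)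
  have le: "norm (F n x - g x) \<le> norm (F n x - f x)" for n x
    using band_zero[OF F] by (cases "\<bar>x\<bar> > A") (auto simp: g_def indicator_def)
  have lim': "(\<lambda>n. \<integral>\<^sup>+x. ennreal ((norm (F n x - g x))\<^sup>2) \<partial>lborel) \<longlonglongrightarrow> 0"
  proof (rule tendsto_sandwich[OF _ _ tendsto_const lim[unfolded tendsto_L2_def]])
    show "\<forall>\<^sub>F n in sequentially. (\<integral>\<^sup>+x. ennreal ((norm (F n x - g x))\<^sup>2) \<partial>lborel)
        \<le> (\<integral>\<^sup>+x. ennreal ((norm (F n x - f x))\<^sup>2) \<partial>lborel)"
      by (intro always_eventually allI nn_integral_mono ennreal_leI power_mono le) auto
  qed simp
  have "\<forall>\<^sub>F n in sequentially. (\<integral>\<^sup>+x. ennreal ((norm (F n x - g x))\<^sup>2) \<partial>lborel) < 1"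
    using lim' by (rule order_tendstoD) simp
  then obtain n where n: "(\<integral>\<^sup>+x. ennreal ((norm (F n x - g x))\<^sup>2) \<partial>lborel) < 1"
    by (auto simp: eventually_sequentially)
  then have "integrable lborel (\<lambda>x. (norm (F n x - g x))\<^sup>2)"
    by (intro integrableI_bounded) (auto intro: less_trans)
  then have "band A (\<lambda>x. F n x - g x)"
    using g0 band_zero[OF F] by (simp add: band_def)
  from band_diff[OF F[of n] this] have g: "band A g"
    by simp
  have "(\<lambda>n. ennreal (sq_norm (\<lambda>x. F n x - g x))) \<longlonglongrightarrow> ennreal 0"
    using lim' by (simp add: nn_integral_eq_sq_norm[OF band_imp_square_integrable[OF band_diff[OF F g]]])
  then have "(\<lambda>n. sq_norm (\<lambda>x. F n x - g x)) \<longlonglongrightarrow> 0"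
    by (subst (asm) tendsto_ennreal_iff) (auto simp: sq_norm_nonneg)
  with g show ?thesis by (rule that)
qed

text \<open>Links unconditional summation over the integers, used by \<open>ell2\<close>, to the
  symmetric partial sums used by \<open>has_dtft\<close>.\<close>

lemma filterlim_symmetric_interval:
  "filterlim (\<lambda>N. {- int N..int N}) (finite_subsets_at_top UNIV) sequentially"
  unfolding filterlim_finite_subsets_at_top
proof (intro allI impI)
  fix X :: "int set" assume "finite X \<and> X \<subseteq> UNIV"
  then have fin: "finite ((\<lambda>n. nat \<bar>n\<bar>) ` X)" by auto
  define N where "N = Max (insert 0 ((\<lambda>n. nat \<bar>n\<bar>) ` X))"
  have N: "nat \<bar>n\<bar> \<le> N" if "n \<in> X" for n
    unfolding N_def using fin that by (intro Max_ge) auto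
  show "\<forall>\<^sub>F M in sequentially. finite {- int M..int M} \<and> X \<subseteq> {- int M..int M} \<and> {- int M..int M} \<subseteq> UNIV"
    using eventually_ge_at_top[of N]
  proof eventually_elim
    case (elim M)
    have "n \<in> {- int M..int M}" if "n \<in> X" for n
      using N[OF that] elim by auto
    then show ?case by auto
  qed
qed

text \<open>A Fourier coefficient is continuous in the L2 norm, and that of the partial sums is
  constantly \<open>c n\<close> as soon as N reaches the modulus of n.\<close>

lemma fcoeff_L2_limit:
  assumes f: "band pi f"
    and lim: "(\<lambda>N. sq_norm (\<lambda>x. fsum {- int N..int N} c x - f x)) \<longlonglongrightarrow> 0"
  shows "fcoeff f n = c n"
proof -
  let ?J = "\<lambda>N. {- int N..int N}"
  have "\<forall>\<^sub>F N in sequentially. 2 * pi * (norm (c n - fcoeff f n))\<^sup>2 \<le> sq_norm (\<lambda>x. fsum (?J N) c x - f x)"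
    using eventually_ge_at_top[of "nat \<bar>n\<bar>"]
  proof eventually_elim
    case (elim N)
    then have "n \<in> ?J N" by auto
    then have "fcoeff (\<lambda>x. fsum (?J N) c x - f x) n = c n - fcoeff f n"
      by (simp add: fcoeff_diff[OF band_fsum f] fcoeff_fsum del: atLeastAtMost_iff)
    then show ?case using norm_fcoeff_square_le[OF band_diff[OF band_fsum f], of "?J N" c n] by simp
  qed
  then have "2 * pi * (norm (c n - fcoeff f n))\<^sup>2 \<le> 0"
    using lim by (intro tendsto_lowerbound[OF lim]) auto
  then have "(norm (c n - fcoeff f n))\<^sup>2 \<le> 0"
    using pi_gt_zero by (auto simp: mult_le_0_iff)
  then show ?thesis by simp
qed

text \<open>The difference of two partial sums is itself a trigonometric sum over the indices
  between them, so by orthogonality its norm is a difference of partial sums of a convergent series,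
  and completeness of L2 applies.\<close>

lemma riesz_fischer:
  assumes "(\<lambda>n. (norm (c n))\<^sup>2) summable_on UNIV"
  obtains f where "band pi f" "\<And>n. fcoeff f n = c n"
    "(\<lambda>N. sq_norm (\<lambda>x. fsum {- int N..int N} c x - f x)) \<longlonglongrightarrow> 0"
proof -
  let ?J = "\<lambda>N. {- int N..int N}"
  have sq: "sq_norm (\<lambda>x. fsum (?J m) c x - fsum (?J n) c x) = 2 * pi * ((\<Sum>k\<in>?J m. (norm (c k))\<^sup>2) - (\<Sum>k\<in>?J n. (norm (c k))\<^sup>2))"
    if "n \<le> m" for m n
  proof -
    have sub: "?J n \<subseteq> ?J m" using that by auto
    have "fsum (?J m) c x - fsum (?J n) c x = fsum (?J m - ?J n) c x" for x
      using sub by (simp add: fsum_def sum_diff right_diff_distrib)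
    then show ?thesis using sub by (simp add: sq_norm_fsum sum_diff)
  qed
  obtain s where "((\<lambda>n. (norm (c n))\<^sup>2) has_sum s) UNIV"
    using assms by (auto simp: summable_on_def)
  then have "(\<lambda>N. \<Sum>k\<in>?J N. (norm (c k))\<^sup>2) \<longlonglongrightarrow> s"
    unfolding has_sum_def by (rule filterlim_compose[OF _ filterlim_symmetric_interval])
  then have C: "Cauchy (\<lambda>N. \<Sum>k\<in>?J N. (norm (c k))\<^sup>2)"
    by (rule LIMSEQ_imp_Cauchy)
  have cauchy: "\<exists>N. \<forall>m\<ge>N. \<forall>n\<ge>N. (\<integral>\<^sup>+x. ennreal ((norm (fsum (?J m) c x - fsum (?J n) c x))\<^sup>2) \<partial>lborel) \<le> ennreal e"
    if e: "e > 0" for e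
  proof -
    have "e / (2 * pi) > 0" using e by simp
    then obtain N where N: "\<And>m n. m \<ge> N \<Longrightarrow> n \<ge> N \<Longrightarrow>
        \<bar>(\<Sum>k\<in>?J m. (norm (c k))\<^sup>2) - (\<Sum>k\<in>?J n. (norm (c k))\<^sup>2)\<bar> < e / (2 * pi)"
      using CauchyD[OF C] unfolding real_norm_def by blast
    have *: "sq_norm (\<lambda>x. fsum (?J m) c x - fsum (?J n) c x) \<le> e" if "m \<ge> N" "n \<ge> N" "n \<le> m" for m n
      using N[OF that(1,2)] sq[OF that(3)] by (simp add: field_simps abs_less_iff)
    have "sq_norm (\<lambda>x. fsum (?J m) c x - fsum (?J n) c x) \<le> e" if "m \<ge> N" "n \<ge> N" for m n
      using *[of m n] *[of n m] that sq_norm_minus_commute[of "fsum (?J m) c" "fsum (?J n) c"]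
      by (cases "n \<le> m") auto
    then show ?thesis
      by (auto simp: nn_integral_eq_sq_norm[OF band_imp_square_integrable[OF band_diff[OF band_fsum band_fsum]]] intro!: exI[of _ N] ennreal_leI)
  qed
  have "fsum J c \<in> borel_measurable lborel" for J
    using band_measurable[OF band_fsum] by simp
  then obtain f0 where f0: "f0 \<in> borel_measurable lborel" "tendsto_L2 lborel (\<lambda>N. fsum (?J N) c) f0 sequentially"
    using L2_complete[of "\<lambda>N. fsum (?J N) c" lborel, OF _ cauchy] by blast
  obtain f where f: "band pi f" and lim: "(\<lambda>N. sq_norm (\<lambda>x. fsum (?J N) c x - f x)) \<longlonglongrightarrow> 0"
    using band_of_L2_limit[OF band_fsum f0] by blast
  have "fcoeff f n = c n" for n
    by (rule fcoeff_L2_limit[OF f lim])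
  with f lim show ?thesis using that by blast
qed

lemma fcoeff_eq_imp_AE_eq:
  assumes f: "band pi f" and g: "band pi g" and eq: "\<And>n. fcoeff f n = fcoeff g n"
  shows "AE x in lborel. f x = g x"
proof -
  have "zero_coeffs (\<lambda>x. f x - g x)"
    using fcoeff_diff[OF f g] eq band_integrable[OF band_diff[OF f g]]
    by (simp add: zero_coeffs_def fcoeff_def)
  then have "AE x in lborel. f x - g x = 0"
    by (rule zero_coeffs_imp_AE_zero) (simp add: band_zero[OF f] band_zero[OF g])
  then show ?thesis by simp
qed

lemma sq_norm_cong_AE:
  assumes "AE x in lborel. f x = g x" "f \<in> borel_measurable borel" "g \<in> borel_measurable borel"
  shows "sq_norm f = sq_norm g"
  unfolding sq_norm_def using assms by (intro integral_cong_AE) auto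

text \<open>Bessel's inequality makes the coefficients square-summable, so they are the coefficients
  of some limit \<open>g\<close> of trigonometric sums. Completeness identifies \<open>g\<close>
  with \<open>f\<close> almost everywhere, and Bessel's identity becomes Parseval's in the
  limit.\<close>

lemma fourier_series:
  assumes f: "band pi f"
  shows fourier_series_L2: "(\<lambda>N. sq_norm (\<lambda>x. fsum {- int N..int N} (fcoeff f) x - f x)) \<longlonglongrightarrow> 0"
    and parseval: "((\<lambda>n. (norm (fcoeff f n))\<^sup>2) has_sum (sq_norm f / (2 * pi))) UNIV"
proof -
  let ?J = "\<lambda>N. {- int N..int N}"
  have "(\<lambda>n. (norm (fcoeff f n))\<^sup>2) summable_on UNIV"
  proof (rule nonneg_bdd_above_summable_on)
    have "(\<Sum>n\<in>J. (norm (fcoeff f n))\<^sup>2) \<le> sq_norm f / (2 * pi)" if "finite J" for J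
      using bessel_identity[OF f that] sq_norm_nonneg[of "\<lambda>x. f x - fsum J (fcoeff f) x"]
      by (simp add: field_simps)
    then show "bdd_above (sum (\<lambda>n. (norm (fcoeff f n))\<^sup>2) ` {F. F \<subseteq> UNIV \<and> finite F})"
      by (intro bdd_aboveI[of _ "sq_norm f / (2 * pi)"]) auto
  qed simp
  then obtain s where s: "((\<lambda>n. (norm (fcoeff f n))\<^sup>2) has_sum s) UNIV"
    and "(\<lambda>n. (norm (fcoeff f n))\<^sup>2) summable_on UNIV"
    by (auto simp: summable_on_def)
  then obtain g where g: "band pi g" "\<And>n. fcoeff g n = fcoeff f n"
    and lim: "(\<lambda>N. sq_norm (\<lambda>x. fsum (?J N) (fcoeff f) x - g x)) \<longlonglongrightarrow> 0"
    using riesz_fischer[of "fcoeff f"] by blast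
  have fg: "AE x in lborel. f x = g x"
    using f g by (intro fcoeff_eq_imp_AE_eq) auto
  have "sq_norm (\<lambda>x. fsum (?J N) (fcoeff f) x - g x) = sq_norm (\<lambda>x. fsum (?J N) (fcoeff f) x - f x)" for N
    using fg by (intro sq_norm_cong_AE band_measurable[OF band_diff[OF band_fsum f]]
        band_measurable[OF band_diff[OF band_fsum g(1)]]) (auto elim: eventually_mono)
  with lim show L: "(\<lambda>N. sq_norm (\<lambda>x. fsum (?J N) (fcoeff f) x - f x)) \<longlonglongrightarrow> 0"
    by simp
  have "(\<lambda>N. \<Sum>k\<in>?J N. (norm (fcoeff f k))\<^sup>2) \<longlonglongrightarrow> s"
    using s unfolding has_sum_def by (rule filterlim_compose[OF _ filterlim_symmetric_interval])
  then have "(\<lambda>N. sq_norm f - 2 * pi * (\<Sum>k\<in>?J N. (norm (fcoeff f k))\<^sup>2)) \<longlonglongrightarrow> sq_norm f - 2 * pi * s"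
    by (intro tendsto_intros)
  moreover have "(\<lambda>N. sq_norm f - 2 * pi * (\<Sum>k\<in>?J N. (norm (fcoeff f k))\<^sup>2)) \<longlonglongrightarrow> 0"
    using L by (subst (asm) sq_norm_minus_commute) (simp add: bessel_identity[OF f])
  ultimately have "sq_norm f - 2 * pi * s = 0"
    by (rule LIMSEQ_unique)
  then have "s = sq_norm f / (2 * pi)" by simp
  with s show "((\<lambda>n. (norm (fcoeff f n))\<^sup>2) has_sum (sq_norm f / (2 * pi))) UNIV" by simp
qed

section \<open>Sampling and the Plancherel theorem\<close>

definition invF :: "(real \<Rightarrow> complex) \<Rightarrow> real \<Rightarrow> complex" where
  "invF g t = (LINT x|lborel. g x * cis (2 * pi * x * t))"

lemma invF_integrable:
  assumes "band A g"
  shows "integrable lborel (\<lambda>x. g x * cis (2 * pi * x * t))"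
  using integrable_mult_cis[OF band_integrable[OF assms], of "2 * pi * t"] by (simp add: mult_ac)

lemma invF_diff:
  assumes "band A f" "band A g"
  shows "invF (\<lambda>x. f x - g x) t = invF f t - invF g t"
  using assms[THEN invF_integrable] by (simp add: invF_def left_diff_distrib)

lemma invF_add:
  assumes "band A f" "band A g"
  shows "invF (\<lambda>x. f x + g x) t = invF f t + invF g t"
  using assms[THEN invF_integrable] by (simp add: invF_def distrib_right)

lemma invF_cmult: "invF (\<lambda>x. c * g x) t = c * invF g t"
  by (simp add: invF_def mult.assoc)

lemma invF_cong_AE:
  assumes "AE x in lborel. f x = g x" and [measurable]: "f \<in> borel_measurable borel" "g \<in> borel_measurable borel"
  shows "invF f = invF g"
proof
  fix t show "invF f t = invF g t"
    unfolding invF_def using assms(1) by (intro integral_cong_AE) auto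
qed

lemma isCont_invF:
  assumes "band A g"
  shows "isCont (invF g) t"
proof (rule continuous_at_sequentiallyI)
  fix u assume u: "u \<longlonglongrightarrow> t"
  have [measurable]: "g \<in> borel_measurable borel" by (rule band_measurable[OF assms])
  show "(\<lambda>n. invF g (u n)) \<longlonglongrightarrow> invF g t"
    unfolding invF_def
  proof (rule integral_dominated_convergence[where w = "\<lambda>x. norm (g x)"])
    have "isCont cis z" for z
      using continuous_on_cis[OF continuous_on_id, of UNIV]
      by (simp add: continuous_on_eq_continuous_at)
    then show "AE x in lborel. (\<lambda>n. g x * cis (2 * pi * x * u n)) \<longlonglongrightarrow> g x * cis (2 * pi * x * t)"
      by (intro AE_I2 tendsto_intros isCont_tendsto_compose[of _ cis] u)
  qed (use band_integrable[OF assms] in \<open>auto simp: norm_mult\<close>)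
qed

lemma continuous_on_invF: "band A g \<Longrightarrow> continuous_on UNIV (invF g)"
  by (simp add: continuous_on_eq_continuous_at isCont_invF)

lemma band_modulate:
  assumes "band A g"
  shows "band A (\<lambda>x. g x * cis (2 * pi * x * t))"
  using band_mult_bounded[OF assms, of "\<lambda>x. cis (2 * pi * x * t)"] by (simp add: mult.commute)

lemma invF_modulate: "invF (\<lambda>x. g x * cis (2 * pi * x * t)) s = invF g (s + t)"
  by (simp add: invF_def mult.assoc cis_mult distrib_left add.commute)

text \<open>The change of variable from cycles per unit to angle per sample, theta = 2 pi S x, which
  carries [-1/(2S), 1/(2S)] onto [-pi, pi]. The prefactor is the Jacobian, so that Fourier
  coefficients become samples of \<open>invF g\<close> up to the factor 1/(2 pi).\<close>

definition rescale :: "real \<Rightarrow> (real \<Rightarrow> complex) \<Rightarrow> real \<Rightarrow> complex" where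
  "rescale S g x = g (x / (2 * pi * S)) / (2 * pi * S)"

lemma
  assumes S: "S > 0" and g: "band (1 / (2 * S)) g"
  shows band_rescale: "band pi (rescale S g)"
    and fcoeff_rescale: "fcoeff (rescale S g) n = invF g (of_int n * S) / (2 * pi)"
    and sq_norm_rescale: "sq_norm (rescale S g) = sq_norm g / (2 * pi * S)"
proof -
  let ?c = "2 * pi * S"
  have c: "?c > 0" using S by simp
  have [measurable]: "g \<in> borel_measurable borel" by (rule band_measurable[OF g])
  have "integrable lborel (\<lambda>x. (norm (g (0 + (1 / ?c) * x)))\<^sup>2)"
    using c by (subst lborel_integrable_real_affine_iff) (auto simp: band_square_integrable[OF g])
  then have "integrable lborel (\<lambda>x. (norm (g (x / ?c)))\<^sup>2 / ?c\<^sup>2)"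
    by simp
  moreover have "(\<lambda>x. (norm (rescale S g x))\<^sup>2) = (\<lambda>x. (norm (g (x / ?c)))\<^sup>2 / ?c\<^sup>2)"
    using S by (simp add: rescale_def norm_divide norm_mult power_divide power_mult_distrib)
  moreover have "rescale S g x = 0" if "\<bar>x\<bar> > pi" for x
  proof -
    have "\<bar>x / ?c\<bar> > 1 / (2 * S)"
      using that S by (simp add: abs_mult field_simps)
    then show ?thesis by (simp add: rescale_def band_zero[OF g])
  qed
  moreover have "rescale S g \<in> borel_measurable borel"
    unfolding rescale_def[abs_def] by measurable
  ultimately show "band pi (rescale S g)"
    by (simp add: band_def)
  have "(LINT x|lborel. rescale S g x * cis (of_int n * x))
      = \<bar>?c\<bar> *\<^sub>R (LINT x|lborel. rescale S g (0 + ?c * x) * cis (of_int n * (0 + ?c * x)))"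
    using c by (intro lborel_integral_real_affine) auto
  also have "\<dots> = (LINT x|lborel. ?c *\<^sub>R (rescale S g (?c * x) * cis (of_int n * (?c * x))))"
    using c by (simp del: scaleR_conv_of_real)
  also have "(\<lambda>x. ?c *\<^sub>R (rescale S g (?c * x) * cis (of_int n * (?c * x)))) = (\<lambda>x. g x * cis (2 * pi * x * (of_int n * S)))"
    using S by (auto simp: rescale_def scaleR_conv_of_real mult_ac)
  finally show "fcoeff (rescale S g) n = invF g (of_int n * S) / (2 * pi)"
    by (simp add: fcoeff_def invF_def)
  have "(LINT x|lborel. (norm (rescale S g x))\<^sup>2) = \<bar>?c\<bar> *\<^sub>R (LINT x|lborel. (norm (rescale S g (0 + ?c * x)))\<^sup>2)"
    using c by (intro lborel_integral_real_affine) auto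
  also have "(\<lambda>x. (norm (rescale S g (0 + ?c * x)))\<^sup>2) = (\<lambda>x. (norm (g x))\<^sup>2 / ?c\<^sup>2)"
    using S by (auto simp: rescale_def norm_divide norm_mult power_divide power_mult_distrib)
  finally show "sq_norm (rescale S g) = sq_norm g / (2 * pi * S)"
    using c by (simp add: sq_norm_def power2_eq_square)
qed

lemma parseval_samples:
  assumes S: "S > 0" and g: "band (1 / (2 * S)) g"
  shows "((\<lambda>n::int. (norm (invF g (of_int n * S)))\<^sup>2) has_sum (sq_norm g / S)) UNIV"
proof -
  have "((\<lambda>n::int. (2 * pi)\<^sup>2 * (norm (fcoeff (rescale S g) n))\<^sup>2) has_sum ((2 * pi)\<^sup>2 * (sq_norm (rescale S g) / (2 * pi)))) UNIV"
    by (intro has_sum_cmult_right parseval band_rescale assms)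
  then show ?thesis
    using assms by (simp add: fcoeff_rescale sq_norm_rescale norm_divide norm_mult power_divide power2_eq_square)
qed

text \<open>The half-open cells of length \<open>S\<close> partition the line. Translating each to
  [0, S) turns the integral into that of the periodization over one period, where it is the constant
  \<open>c\<close>.\<close>

lemma nn_integral_periodization:
  fixes f :: "real \<Rightarrow> real"
  assumes S: "S > 0" and [measurable]: "f \<in> borel_measurable borel" and f0: "\<And>t. f t \<ge> 0"
    and sum: "\<And>t. ((\<lambda>n::int. f (t + of_int n * S)) has_sum c) UNIV"
  shows "(\<integral>\<^sup>+t. ennreal (f t) \<partial>lborel) = ennreal (S * c)"
proof -
  let ?J = "\<lambda>N. {- int N..int N}"
  let ?I = "\<lambda>n::int. indicator {of_int n * S..<(of_int n + 1) * S} :: real \<Rightarrow> ennreal"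
  have I: "?I n t = (if n = \<lfloor>t / S\<rfloor> then 1 else 0)" for n t
  proof -
    have "t \<in> {of_int n * S..<(of_int n + 1) * S} \<longleftrightarrow> n = \<lfloor>t / S\<rfloor>"
      using S by (auto simp: field_simps floor_eq_iff eq_commute[of n])
    then show ?thesis by (simp add: indicator_def)
  qed
  have "(\<lambda>N. \<integral>\<^sup>+t. (\<Sum>n\<in>?J N. ?I n t * ennreal (f t)) \<partial>lborel) \<longlonglongrightarrow> (\<integral>\<^sup>+t. ennreal (f t) \<partial>lborel)"
  proof (rule nn_integral_LIMSEQ)
    show "incseq (\<lambda>N t. \<Sum>n\<in>?J N. ?I n t * ennreal (f t))"
      by (intro incseq_SucI le_funI sum_mono2) auto
    show "(\<lambda>N. \<Sum>n\<in>?J N. ?I n t * ennreal (f t)) \<longlonglongrightarrow> ennreal (f t)" for t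
    proof (rule tendsto_eventually)
      show "\<forall>\<^sub>F N in sequentially. (\<Sum>n\<in>?J N. ?I n t * ennreal (f t)) = ennreal (f t)"
        using eventually_ge_at_top[of "nat \<bar>\<lfloor>t / S\<rfloor>\<bar>"]
      proof eventually_elim
        case (elim N)
        then have "\<lfloor>t / S\<rfloor> \<in> ?J N" by auto
        moreover have "(\<Sum>n\<in>?J N. ?I n t * ennreal (f t)) = (\<Sum>n\<in>?J N. if n = \<lfloor>t / S\<rfloor> then ennreal (f t) else 0)"
          unfolding I by (intro sum.cong) auto
        ultimately show ?case by simp
      qed
    qed
  qed measurable
  moreover have "(\<lambda>N. \<integral>\<^sup>+t. (\<Sum>n\<in>?J N. ?I n t * ennreal (f t)) \<partial>lborel) \<longlonglongrightarrow> (\<integral>\<^sup>+t. ennreal c * indicator {0..<S} t \<partial>lborel)"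
  proof -
    have tr: "(\<integral>\<^sup>+t. ?I n t * ennreal (f t) \<partial>lborel) = (\<integral>\<^sup>+t. indicator {0..<S} t * ennreal (f (t + of_int n * S)) \<partial>lborel)" for n
    proof -
      have "?I n (of_int n * S + t) = indicator {0..<S} t" for t
        by (auto simp: indicator_def algebra_simps)
      then show ?thesis
        by (subst nn_integral_real_affine[where c = 1 and t = "of_int n * S"]) (auto simp: add.commute)
    qed
    have "(\<integral>\<^sup>+t. (\<Sum>n\<in>?J N. ?I n t * ennreal (f t)) \<partial>lborel)
        = (\<integral>\<^sup>+t. ennreal (\<Sum>n\<in>?J N. f (t + of_int n * S)) * indicator {0..<S} t \<partial>lborel)" for N
    proof -
      have "(\<integral>\<^sup>+t. (\<Sum>n\<in>?J N. ?I n t * ennreal (f t)) \<partial>lborel) = (\<Sum>n\<in>?J N. \<integral>\<^sup>+t. ?I n t * ennreal (f t) \<partial>lborel)"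
        by (rule nn_integral_sum) measurable
      also have "\<dots> = (\<Sum>n\<in>?J N. \<integral>\<^sup>+t. indicator {0..<S} t * ennreal (f (t + of_int n * S)) \<partial>lborel)"
        by (simp only: tr)
      also have "\<dots> = (\<integral>\<^sup>+t. (\<Sum>n\<in>?J N. indicator {0..<S} t * ennreal (f (t + of_int n * S))) \<partial>lborel)"
        by (rule nn_integral_sum[symmetric]) measurable
      also have "\<dots> = (\<integral>\<^sup>+t. ennreal (\<Sum>n\<in>?J N. f (t + of_int n * S)) * indicator {0..<S} t \<partial>lborel)"
        by (intro nn_integral_cong) (simp only: sum_distrib_left[symmetric] sum_ennreal[OF f0] mult.commute)
      finally show ?thesis .
    qed
    moreover have "(\<lambda>N. \<integral>\<^sup>+t. ennreal (\<Sum>n\<in>?J N. f (t + of_int n * S)) * indicator {0..<S} t \<partial>lborel)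
        \<longlonglongrightarrow> (\<integral>\<^sup>+t. ennreal c * indicator {0..<S} t \<partial>lborel)"
    proof (rule nn_integral_LIMSEQ)
      show "incseq (\<lambda>N t. ennreal (\<Sum>n\<in>?J N. f (t + of_int n * S)) * indicator {0..<S} t)"
        by (intro incseq_SucI le_funI mult_right_mono ennreal_leI sum_mono2) (auto simp: f0)
      show "(\<lambda>N. ennreal (\<Sum>n\<in>?J N. f (t + of_int n * S)) * indicator {0..<S} t)
          \<longlonglongrightarrow> ennreal c * indicator {0..<S} t" for t
      proof (cases "t \<in> {0..<S}")
        case True
        have "(\<lambda>N. \<Sum>n\<in>?J N. f (t + of_int n * S)) \<longlonglongrightarrow> c"
          using sum unfolding has_sum_def by (rule filterlim_compose[OF _ filterlim_symmetric_interval])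
        then show ?thesis using True by (auto intro!: tendsto_intros)
      qed simp
    qed auto
    ultimately show ?thesis by simp
  qed
  ultimately have "(\<integral>\<^sup>+t. ennreal (f t) \<partial>lborel) = (\<integral>\<^sup>+t. ennreal c * indicator {0..<S} t \<partial>lborel)"
    by (rule LIMSEQ_unique)
  also have "\<dots> = ennreal (S * c)"
  proof -
    have "c \<ge> 0" using has_sum_nonneg[OF sum] f0 by blast
    then show ?thesis using S by (simp add: nn_integral_cmult_indicator ennreal_mult[symmetric] mult.commute)
  qed
  finally show ?thesis .
qed

lemma sq_norm_modulate: "sq_norm (\<lambda>x. g x * cis (2 * pi * x * t)) = sq_norm g"
  by (simp add: sq_norm_def norm_mult)

lemma plancherel:
  assumes g: "band A g"
  shows "square_integrable lborel (invF g)" and "sq_norm (invF g) = sq_norm g"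
proof -
  \<comment> \<open>A sampling period fine enough for the band [-A, A]; the maximum keeps it
    positive for every \<open>A\<close>.\<close>
  define S where "S = 1 / (2 * max A 1)"
  have S: "S > 0" "1 / (2 * S) = max A 1" by (auto simp: S_def)
  have g': "band (1 / (2 * S)) g" using g unfolding S(2) by (rule band_mono) simp
  have [measurable]: "invF g \<in> borel_measurable borel"
    by (rule borel_measurable_continuous_onI[OF continuous_on_invF[OF g]])
  \<comment> \<open>Modulating the spectrum moves the sampling grid by \<open>t\<close> without
    changing the norm, so the sum of squares is the same for every offset.\<close>
  have "((\<lambda>n::int. (norm (invF g (t + of_int n * S)))\<^sup>2) has_sum (sq_norm g / S)) UNIV" for t
    using parseval_samples[OF S(1) band_modulate[OF g', of t]]
    by (simp add: sq_norm_modulate invF_modulate add.commute)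
  then have nn: "(\<integral>\<^sup>+t. ennreal ((norm (invF g t))\<^sup>2) \<partial>lborel) = ennreal (S * (sq_norm g / S))"
    using S by (intro nn_integral_periodization) auto
  then have "integrable lborel (\<lambda>t. (norm (invF g t))\<^sup>2)"
    by (intro integrableI_bounded) auto
  then show sq: "square_integrable lborel (invF g)"
    by (simp add: square_integrable_def)
  show "sq_norm (invF g) = sq_norm g"
    using nn S by (simp add: nn_integral_eq_sq_norm[OF sq] sq_norm_nonneg)
qed

text \<open>Fubini, with an absolutely integrable kernel because both functions are integrable.
  Conjugating the character reverses its sign, whence the reflection: \<open>invF h (- x)\<close> is
  the forward transform of \<open>h\<close>.\<close>

lemma invF_adjoint:
  assumes h: "band R h" and g: "band A g"
  shows "(LINT t|lborel. h t * cnj (invF g t)) = (LINT x|lborel. invF h (- x) * cnj (g x))"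
proof -
  have [measurable]: "h \<in> borel_measurable borel" "g \<in> borel_measurable borel"
    using assms by (auto dest: band_measurable)
  let ?k = "\<lambda>t x. h t * cnj (g x) * cis (- (2 * pi * x * t))"
  have int: "integrable (lborel \<Otimes>\<^sub>M lborel) (\<lambda>(t, x). ?k t x)"
  proof (rule lborel_pair.Fubini_integrable)
    show "(\<lambda>(t, x). ?k t x) \<in> borel_measurable (lborel \<Otimes>\<^sub>M lborel)"
      by measurable
    show "integrable lborel (\<lambda>t. LINT x|lborel. norm (case (t, x) of (t, x) \<Rightarrow> ?k t x))"
      using band_integrable[OF h] by (simp add: norm_mult)
    have "integrable lborel (\<lambda>x. ?k t x)" for t
    proof (rule Bochner_Integration.integrable_bound)
      show "integrable lborel (\<lambda>x. h t * g x)" using band_integrable[OF g] by simp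
    qed (auto simp: norm_mult)
    then show "AE t in lborel. integrable lborel (\<lambda>x. case (t, x) of (t, x) \<Rightarrow> ?k t x)"
      by simp
  qed
  have "(LINT t|lborel. h t * cnj (invF g t)) = (LINT t|lborel. LINT x|lborel. ?k t x)"
  proof (rule Bochner_Integration.integral_cong[OF refl])
    fix t
    have "cnj (invF g t) = (LINT x|lborel. cnj (g x * cis (2 * pi * x * t)))"
      by (simp only: invF_def Bochner_Integration.integral_cnj)
    then show "h t * cnj (invF g t) = (LINT x|lborel. ?k t x)"
      by (simp add: cis_cnj mult.assoc)
  qed
  also have "\<dots> = (LINT x|lborel. LINT t|lborel. ?k t x)"
    using lborel_pair.Fubini_integral[OF int] by simp
  also have "\<dots> = (LINT x|lborel. invF h (- x) * cnj (g x))"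
  proof (rule Bochner_Integration.integral_cong[OF refl])
    fix x
    have "(\<lambda>t. ?k t x) = (\<lambda>t. (h t * cis (2 * pi * t * - x)) * cnj (g x))"
      by (auto simp: mult_ac)
    then show "(LINT t|lborel. ?k t x) = invF h (- x) * cnj (g x)"
      by (simp add: invF_def)
  qed
  finally show ?thesis .
qed

lemma square_integrable_reflect:
  fixes f :: "real \<Rightarrow> complex"
  assumes "square_integrable lborel f"
  shows "square_integrable lborel (\<lambda>x. f (- x))" and "sq_norm (\<lambda>x. f (- x)) = sq_norm f"
proof -
  have [measurable]: "f \<in> borel_measurable borel" using assms by (simp add: square_integrable_def)
  have "integrable lborel (\<lambda>x. (norm (f (0 + (-1) * x)))\<^sup>2)"
    using assms by (subst lborel_integrable_real_affine_iff) (auto simp: square_integrable_def)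
  then show "square_integrable lborel (\<lambda>x. f (- x))" by (simp add: square_integrable_def)
  show "sq_norm (\<lambda>x. f (- x)) = sq_norm f"
    unfolding sq_norm_def by (subst (2) lborel_integral_real_affine[where c = "-1" and t = 0]) auto
qed

text \<open>Both norms expand to \<open>sq_norm h + sq_norm g\<close> minus the same cross term. Taking for \<open>h\<close> the
  truncations of a function, this turns convergence of their transforms to \<open>g\<close> into convergence
  of the truncations to \<open>invF g\<close>, and conversely.\<close>
lemma sq_norm_diff_invF:
  assumes h: "band R h" and g: "band A g"
  shows "sq_norm (\<lambda>t. h t - invF g t) = sq_norm (\<lambda>x. invF h (- x) - g x)"
  by (simp add: sq_norm_diff plancherel[OF h] plancherel[OF g] square_integrable_reflect invF_adjoint[OF h g]
      band_imp_square_integrable[OF h] band_imp_square_integrable[OF g])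

section \<open>Band-limited reconstruction and the ideal low-pass filter\<close>

text \<open>The spectral form of real-valuedness. It is a pointwise symmetry, which
  \<open>hermitian_part\<close> arranges by changing the representative of the spectrum.\<close>

definition herm :: "(real \<Rightarrow> complex) \<Rightarrow> bool" where
  "herm g \<longleftrightarrow> (\<forall>x. g (- x) = cnj (g x))"

lemma invF_cnj_reflect: "invF (\<lambda>x. cnj (g (- x))) t = cnj (invF g t)"
proof -
  have "invF (\<lambda>x. cnj (g (- x))) t = \<bar>-1\<bar> *\<^sub>R (LINT x|lborel. cnj (g (- (0 + (-1) * x))) * cis (2 * pi * (0 + (-1) * x) * t))"
    unfolding invF_def by (rule lborel_integral_real_affine) simp
  also have "\<dots> = (LINT x|lborel. cnj (g x * cis (2 * pi * x * t)))"
    by (simp add: cis_cnj)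
  finally show ?thesis
    by (simp only: invF_def Bochner_Integration.integral_cnj)
qed

lemma invF_herm:
  assumes "herm g"
  shows "complex_of_real (Re (invF g t)) = invF g t"
proof -
  have "(\<lambda>x. cnj (g (- x))) = g" using assms by (simp add: herm_def)
  then have "cnj (invF g t) = invF g t" using invF_cnj_reflect[of g t] by simp
  then show ?thesis by (simp add: complex_eq_iff)
qed

lemma norm_invF_herm: "herm g \<Longrightarrow> (norm (invF g t))\<^sup>2 = (Re (invF g t))\<^sup>2"
  using invF_herm[of g t] by (metis norm_of_real power2_abs)

lemma band_reflect:
  assumes g: "band A g"
  shows "band A (\<lambda>x. cnj (g (- x)))"
proof -
  have [measurable]: "g \<in> borel_measurable borel" by (rule band_measurable[OF g])
  have "square_integrable lborel (\<lambda>x. g (- x))"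
    by (rule square_integrable_reflect[OF band_imp_square_integrable[OF g]])
  then show ?thesis
    using band_zero[OF g] by (simp add: band_def square_integrable_def)
qed

text \<open>Conjugating and reflecting a spectrum conjugates its inverse transform, so averaging the
  two extracts the real part while keeping the band.\<close>

lemma hermitian_part:
  assumes g: "band A g"
  obtains h where "band A h" "herm h" "\<And>t. invF h t = complex_of_real (Re (invF g t))"
proof
  let ?h = "\<lambda>x. (1 / 2) * (g x + cnj (g (- x)))"
  show "band A ?h" by (intro band_cmult band_add band_reflect g)
  show "herm ?h" by (simp add: herm_def add.commute)
  show "invF ?h t = complex_of_real (Re (invF g t))" for t
    unfolding invF_cmult invF_add[OF g band_reflect[OF g]] invF_cnj_reflect
    by (simp add: complex_eq_iff)
qed

lemma herm_modulate: "herm g \<Longrightarrow> herm (\<lambda>x. g x * cis (2 * pi * x * t))"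
  by (simp add: herm_def cis_cnj)

section \<open>Truncation and the Fourier transform as an L2 limit\<close>

definition trunc :: "real \<Rightarrow> (real \<Rightarrow> complex) \<Rightarrow> real \<Rightarrow> complex" where
  "trunc R f x = indicator {-R..R} x * f x"

lemma trunc_eq_if: "trunc R f x = (if \<bar>x\<bar> \<le> R then f x else 0)"
  by (auto simp: trunc_def indicator_def)

lemma band_trunc:
  assumes f: "square_integrable lborel f"
  shows "band R (trunc R f)"
proof -
  have [measurable]: "f \<in> borel_measurable borel" using f by (simp add: square_integrable_def)
  have "integrable lborel (\<lambda>x. (norm (trunc R f x))\<^sup>2)"
  proof (rule Bochner_Integration.integrable_bound)
    show "integrable lborel (\<lambda>x. (norm (f x))\<^sup>2)" using f by (simp add: square_integrable_def)
    show "(\<lambda>x. (norm (trunc R f x))\<^sup>2) \<in> borel_measurable lborel"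
      unfolding trunc_def by measurable
  qed (auto simp: trunc_def indicator_def)
  moreover have "trunc R f \<in> borel_measurable borel" unfolding trunc_def[abs_def] by measurable
  moreover have "trunc R f x = 0" if "\<bar>x\<bar> > R" for x using that by (auto simp: trunc_def indicator_def)
  ultimately show ?thesis by (simp add: band_def)
qed

lemma sq_norm_trunc_tendsto:
  assumes f: "square_integrable lborel f"
  shows "((\<lambda>R. sq_norm (\<lambda>x. trunc R f x - f x)) \<longlongrightarrow> 0) at_top"
proof -
  have fm[measurable]: "f \<in> borel_measurable borel" using f by (simp add: square_integrable_def)
  have [measurable]: "trunc R f \<in> borel_measurable borel" for R
    using band_measurable[OF band_trunc[OF f]] .
  have "((\<lambda>R. LINT x|lborel. (norm (trunc R f x - f x))\<^sup>2) \<longlongrightarrow> (LINT x::real|lborel. 0 :: real)) at_top"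
  proof (rule integral_dominated_convergence_at_top)
    show "integrable lborel (\<lambda>x. (norm (f x))\<^sup>2)" using f by (simp add: square_integrable_def)
    show "AE x in lborel. ((\<lambda>R. (norm (trunc R f x - f x))\<^sup>2) \<longlongrightarrow> 0) at_top"
    proof (intro AE_I2 tendsto_eventually)
      fix x
      show "\<forall>\<^sub>F R in at_top. (norm (trunc R f x - f x))\<^sup>2 = 0"
        using eventually_ge_at_top[of "\<bar>x\<bar>"]
        by eventually_elim (auto simp: trunc_def indicator_def)
    qed
    show "\<forall>\<^sub>F R in at_top. AE x in lborel. norm ((norm (trunc R f x - f x))\<^sup>2) \<le> (norm (f x))\<^sup>2"
      by (intro always_eventually allI AE_I2) (auto simp: trunc_def indicator_def)
  qed auto
  then show ?thesis by (simp add: sq_norm_def)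
qed

lemma continuous_AE_eq:
  fixes f g :: "real \<Rightarrow> complex"
  assumes "continuous_on UNIV f" "continuous_on UNIV g" "AE x in lborel. f x = g x"
  shows "f = g"
proof -
  let ?U = "{x. f x \<noteq> g x}"
  have "open ?U" using assms(1,2) by (intro open_Collect_neq)
  have "?U \<in> null_sets lborel"
    using assms(3) \<open>open ?U\<close> by (subst AE_iff_null_sets) auto
  then have "negligible ?U"
    by (simp add: negligible_iff_null_sets null_sets_completionI)
  then have "?U = {}" using open_not_negligible[OF \<open>open ?U\<close>] by blast
  then show ?thesis by auto
qed

lemma sq_norm_triangle:
  assumes h: "square_integrable lborel h" and f: "square_integrable lborel f" and w: "square_integrable lborel w"
  shows "sq_norm (\<lambda>x. f x - w x) \<le> 2 * sq_norm (\<lambda>x. h x - f x) + 2 * sq_norm (\<lambda>x. h x - w x)"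
proof -
  have "(norm (f x - w x))\<^sup>2 \<le> 2 * (norm (h x - f x))\<^sup>2 + 2 * (norm (h x - w x))\<^sup>2" for x
  proof -
    have "norm (f x - w x) \<le> norm (h x - f x) + norm (h x - w x)"
      using norm_triangle_ineq4[of "h x - w x" "h x - f x"] by simp
    then have "(norm (f x - w x))\<^sup>2 \<le> (norm (h x - f x) + norm (h x - w x))\<^sup>2"
      by (intro power_mono) auto
    also have "\<dots> \<le> 2 * (norm (h x - f x))\<^sup>2 + 2 * (norm (h x - w x))\<^sup>2"
      using zero_le_power2[of "norm (h x - f x) - norm (h x - w x)"]
      by (simp add: power2_sum power2_diff)
    finally show ?thesis .
  qed
  moreover note square_integrable_diff[OF h f] square_integrable_diff[OF h w] square_integrable_diff[OF f w]
  ultimately have "sq_norm (\<lambda>x. f x - w x) \<le> (LINT x|lborel. 2 * (norm (h x - f x))\<^sup>2 + 2 * (norm (h x - w x))\<^sup>2)"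
    unfolding sq_norm_def by (intro integral_mono) (auto simp: square_integrable_def)
  also have "\<dots> = 2 * sq_norm (\<lambda>x. h x - f x) + 2 * sq_norm (\<lambda>x. h x - w x)"
    using square_integrable_diff[OF h f] square_integrable_diff[OF h w]
    by (simp add: sq_norm_def square_integrable_def)
  finally show ?thesis .
qed

lemma fourier_integral_trunc:
  "(LINT t:{-R..R}|lborel. exp (- (2 * pi * \<xi> * t) * \<i>) * f t) = invF (trunc R f) (- \<xi>)"
  unfolding set_lebesgue_integral_def invF_def
  by (intro Bochner_Integration.integral_cong)
    (auto simp: trunc_def indicator_def cis_conv_exp mult_ac)

text \<open>The error of the truncated transforms equals the error of the truncations of
  \<open>invF g\<close> themselves, which tends to 0 because \<open>invF g\<close> is
  square-integrable.\<close>

lemma has_fourier_transform_invF: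
  assumes g: "band A g"
  shows "has_fourier_transform (invF g) g"
proof -
  note w = plancherel(1)[OF g]
  have si: "square_integrable lborel (\<lambda>\<xi>. invF (trunc R (invF g)) (- \<xi>) - g \<xi>)" for R
    by (intro square_integrable_diff square_integrable_reflect plancherel(1)[OF band_trunc[OF w]] band_imp_square_integrable[OF g])
  have "((\<lambda>R. ennreal (sq_norm (\<lambda>x. trunc R (invF g) x - invF g x))) \<longlongrightarrow> ennreal 0) at_top"
    by (intro tendsto_ennrealI sq_norm_trunc_tendsto[OF w])
  then show ?thesis
    unfolding has_fourier_transform_def tendsto_L2_def fourier_integral_trunc nn_integral_eq_sq_norm[OF si]
      sq_norm_diff_invF[OF band_trunc[OF w] g]
    using w band_imp_square_integrable[OF g] by simp
qed

text \<open>The truncations of \<open>f\<close> converge in L2 both to \<open>f\<close> and to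
  \<open>invF h\<close>, so the two agree almost everywhere; continuity upgrades this to equality at
  every point, and hence at the sampling points.\<close>

lemma has_fourier_transform_unique:
  assumes ft: "has_fourier_transform f g" and f: "continuous_on UNIV f"
    and h: "band A h" and gh: "AE \<xi> in lborel. g \<xi> = h \<xi>"
  shows "f = invF h"
proof -
  have sf: "square_integrable lborel f" and sg: "square_integrable lborel g"
    using ft by (auto simp: has_fourier_transform_def)
  have [measurable]: "g \<in> borel_measurable borel" using sg by (simp add: square_integrable_def)
  have [measurable]: "h \<in> borel_measurable borel" by (rule band_measurable[OF h])
  note t = band_trunc[OF sf]
  note w = plancherel(1)[OF h]
  have si: "square_integrable lborel (\<lambda>\<xi>. invF (trunc R f) (- \<xi>) - h \<xi>)" for R
    by (intro square_integrable_diff square_integrable_reflect plancherel(1)[OF t] band_imp_square_integrable[OF h])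
  have "(\<integral>\<^sup>+\<xi>. ennreal ((norm (invF (trunc R f) (- \<xi>) - g \<xi>))\<^sup>2) \<partial>lborel)
      = ennreal (sq_norm (\<lambda>x. trunc R f x - invF h x))" for R
    unfolding sq_norm_diff_invF[OF t h] nn_integral_eq_sq_norm[OF si, symmetric]
    using gh by (intro nn_integral_cong_AE) (auto elim: eventually_mono)
  then have "((\<lambda>R. ennreal (sq_norm (\<lambda>x. trunc R f x - invF h x))) \<longlongrightarrow> ennreal 0) at_top"
    using ft unfolding has_fourier_transform_def tendsto_L2_def fourier_integral_trunc by simp
  then have l1: "((\<lambda>R. sq_norm (\<lambda>x. trunc R f x - invF h x)) \<longlongrightarrow> 0) at_top"
    by (subst (asm) tendsto_ennreal_iff) (auto simp: sq_norm_nonneg)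
  have "((\<lambda>R. 2 * sq_norm (\<lambda>x. trunc R f x - f x) + 2 * sq_norm (\<lambda>x. trunc R f x - invF h x)) \<longlongrightarrow> 2 * 0 + 2 * 0) at_top"
    by (intro tendsto_intros l1 sq_norm_trunc_tendsto sf)
  then have "sq_norm (\<lambda>x. f x - invF h x) \<le> 2 * 0 + 2 * 0"
    by (rule tendsto_lowerbound)
      (auto intro!: always_eventually sq_norm_triangle sf w band_imp_square_integrable[OF t])
  then have "sq_norm (\<lambda>x. f x - invF h x) = 0"
    using sq_norm_nonneg[of "\<lambda>x. f x - invF h x"] by simp
  then have "AE x in lborel. f x = invF h x"
    using square_integrable_diff[OF sf w] unfolding sq_norm_def
    by (subst (asm) integral_nonneg_eq_0_iff_AE) (auto simp: square_integrable_def)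
  then show ?thesis
    by (rule continuous_AE_eq[OF f continuous_on_invF[OF h]])
qed

text \<open>A concrete parametrization of the signal space by spectra. With it, existence and
  uniqueness of reconstructions become statements about the samples of
  \<open>invF g\<close>.\<close>

lemma bandlimited_iff:
  "z \<in> bandlimited S \<longleftrightarrow> (\<exists>c g. band (1 / (2 * S)) g \<and> herm g \<and> z = (\<lambda>t. c + Re (invF g t)))"
proof
  assume "z \<in> bandlimited S"
  then obtain c z0 g where z: "z = (\<lambda>t. c + z0 t)" and z0: "continuous_on UNIV z0"
    and ft: "has_fourier_transform (\<lambda>t. complex_of_real (z0 t)) g"
    and g: "AE \<xi> in lborel. \<bar>\<xi>\<bar> > 1 / (2 * S) \<longrightarrow> g \<xi> = 0"
    by (auto simp: bandlimited_def)
  \<comment> \<open>The transform vanishes outside the band only almost everywhere; truncation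
    selects the representative for which this holds everywhere.\<close>
  let ?h = "trunc (1 / (2 * S)) g"
  have h: "band (1 / (2 * S)) ?h"
    using ft by (intro band_trunc) (simp add: has_fourier_transform_def)
  have "AE \<xi> in lborel. g \<xi> = ?h \<xi>"
    using g by eventually_elim (auto simp: trunc_def indicator_def)
  then have "(\<lambda>t. complex_of_real (z0 t)) = invF ?h"
    by (intro has_fourier_transform_unique[OF ft _ h] continuous_on_of_real z0)
  moreover obtain k where k: "band (1 / (2 * S)) k" "herm k" "\<And>t. invF k t = complex_of_real (Re (invF ?h t))"
    using hermitian_part[OF h] by blast
  ultimately have "z = (\<lambda>t. c + Re (invF k t))"
    by (simp add: z) (metis Re_complex_of_real)
  with k show "\<exists>c g. band (1 / (2 * S)) g \<and> herm g \<and> z = (\<lambda>t. c + Re (invF g t))" by blast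
next
  assume "\<exists>c g. band (1 / (2 * S)) g \<and> herm g \<and> z = (\<lambda>t. c + Re (invF g t))"
  then obtain c g where g: "band (1 / (2 * S)) g" "herm g" and z: "z = (\<lambda>t. c + Re (invF g t))" by blast
  have w: "(\<lambda>t. complex_of_real (Re (invF g t))) = invF g"
    using invF_herm[OF g(2)] by auto
  have cont: "continuous_on UNIV (\<lambda>t. Re (invF g t))"
    by (intro continuous_on_Re continuous_on_invF[OF g(1)])
  have "square_integrable lborel (\<lambda>t. Re (invF g t))"
    using plancherel(1)[OF g(1)] cont borel_measurable_continuous_onI[OF cont]
    by (simp add: square_integrable_def norm_invF_herm[OF g(2)])
  moreover have "AE \<xi> in lborel. \<bar>\<xi>\<bar> > 1 / (2 * S) \<longrightarrow> g \<xi> = 0"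
    by (simp add: band_zero[OF g(1)])
  ultimately show "z \<in> bandlimited S"
    unfolding bandlimited_def using has_fourier_transform_invF[OF g(1)] cont w z by force
qed

section \<open>Uniqueness of samples and reconstruction modulo constants\<close>

lemma summable_on_const_int:
  fixes k :: real
  assumes "(\<lambda>n::int. k) summable_on UNIV" "k \<ge> 0"
  shows "k = 0"
proof (rule ccontr)
  assume "k \<noteq> 0"
  with assms(2) have k: "k > 0" by simp
  obtain N :: nat where N: "infsum (\<lambda>n::int. k) UNIV < real N * k"
    using reals_Archimedean3[OF k] by blast
  have "(\<Sum>n\<in>{0..<int N}. k) \<le> infsum (\<lambda>n::int. k) UNIV"
    using assms by (intro finite_sum_le_infsum) auto
  then show False using N by simp
qed

text \<open>The difference of the constants is a difference of two square-summable sequences, so its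
  square is a summable constant over the integers and must be 0.\<close>

lemma ell2_plus_const_unique:
  assumes x: "x \<in> ell2" and y: "y \<in> ell2" and eq: "\<And>n. c + x n = c' + y n"
  shows "c = c'" "x = y"
proof -
  have "(\<lambda>n. 2 * (x n)\<^sup>2 + 2 * (y n)\<^sup>2) summable_on UNIV"
    using x y by (intro summable_on_add summable_on_cmult_right) (auto simp: ell2_def)
  moreover have "(c' - c)\<^sup>2 \<le> 2 * (x n)\<^sup>2 + 2 * (y n)\<^sup>2" for n
  proof -
    have "c' - c = x n - y n" using eq[of n] by simp
    moreover have "0 \<le> (x n + y n)\<^sup>2" by simp
    ultimately show ?thesis by (simp add: power2_sum power2_diff)
  qed
  ultimately have "(\<lambda>n::int. (c' - c)\<^sup>2) summable_on UNIV"
    by (rule summable_on_comparison_test) auto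
  then have "(c' - c)\<^sup>2 = 0" by (rule summable_on_const_int) simp
  then show "c = c'" by simp
  with eq show "x = y" by auto
qed

lemma samples_in_ell2:
  assumes "S > 0" "band (1 / (2 * S)) g" "herm g"
  shows "(\<lambda>n. Re (invF g (of_int n * S))) \<in> ell2"
  using parseval_samples[OF assms(1,2)]
  by (auto simp: ell2_def norm_invF_herm[OF assms(3)] summable_on_def)

text \<open>Once the constants agree, the difference of the spectra has zero samples, and Parseval's
  identity forces its norm to be zero.\<close>

lemma samples_unique:
  assumes S: "S > 0" and f: "band (1 / (2 * S)) f" "herm f" and g: "band (1 / (2 * S)) g" "herm g"
    and eq: "\<And>n::int. c + Re (invF f (of_int n * S)) = c' + Re (invF g (of_int n * S))"
  shows "c = c'" "invF f = invF g"
proof -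
  note * = ell2_plus_const_unique[OF samples_in_ell2[OF S f] samples_in_ell2[OF S g] eq]
  show "c = c'" by (rule *(1))
  let ?d = "\<lambda>x. f x - g x"
  have d: "band (1 / (2 * S)) ?d" by (rule band_diff[OF f(1) g(1)])
  have "invF ?d (of_int n * S) = 0" for n :: int
    using fun_cong[OF *(2), of n] invF_herm[OF f(2)] invF_herm[OF g(2)]
    by (metis invF_diff[OF f(1) g(1)] right_minus_eq)
  then have "sq_norm ?d / S = 0"
    using infsumI[OF parseval_samples[OF S d]] by simp
  then have "AE x in lborel. f x - g x = 0"
    using S by (simp add: sq_norm_eq_0[OF d])
  then show "invF f = invF g"
    by (intro invF_cong_AE band_measurable[OF f(1)] band_measurable[OF g(1)]) simp
qed

text \<open>Resolves the definite description: a signal exhibited as samples of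
  \<open>c + Re (invF g t)\<close> is reconstructed by that same formula at every real
  \<open>t\<close>.\<close>

lemma reconstruct_samples:
  assumes S: "S > 0" and g: "band (1 / (2 * S)) g" "herm g"
  shows "reconstruct S (\<lambda>n. c + Re (invF g (of_int n * S))) = (\<lambda>t. c + Re (invF g t))"
  unfolding reconstruct_def
proof (rule the_equality)
  show "(\<lambda>t. c + Re (invF g t)) \<in> bandlimited S \<and>
    (\<forall>n. c + Re (invF g (of_int n * S)) = c + Re (invF g (of_int n * S)))"
    unfolding bandlimited_iff using g by blast
next
  fix z assume z: "z \<in> bandlimited S \<and> (\<forall>n. c + Re (invF g (of_int n * S)) = z (of_int n * S))"
  then obtain c' h where h: "band (1 / (2 * S)) h" "herm h" and zh: "z = (\<lambda>t. c' + Re (invF h t))"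
    by (auto simp: bandlimited_iff)
  from z have "\<And>n::int. c + Re (invF g (of_int n * S)) = c' + Re (invF h (of_int n * S))"
    by (simp add: zh)
  from samples_unique[OF S g h this] show "z = (\<lambda>t. c + Re (invF g t))"
    by (simp add: zh)
qed

lemma ell2_samples:
  assumes S: "S > 0" and x: "x \<in> ell2"
  obtains g where "band (1 / (2 * S)) g" "herm g" "x = (\<lambda>n. Re (invF g (of_int n * S)))"
proof -
  let ?c = "2 * pi * S"
  have c: "?c > 0" using S by simp
  have "(\<lambda>n. (norm (complex_of_real (x n)))\<^sup>2) summable_on UNIV"
    using x by (simp add: ell2_def)
  then have "(\<lambda>n. (1 / (2 * pi))\<^sup>2 * (norm (complex_of_real (x n)))\<^sup>2) summable_on UNIV"
    by (rule summable_on_cmult_right)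
  then have "(\<lambda>n. (norm (complex_of_real (x n) / (2 * pi)))\<^sup>2) summable_on UNIV"
    by (simp add: norm_divide power_divide)
  then obtain f where f: "band pi f" "\<And>n. fcoeff f n = complex_of_real (x n) / (2 * pi)"
    using riesz_fischer[of "\<lambda>n. complex_of_real (x n) / complex_of_real (2 * pi)"] by blast
  \<comment> \<open>The inverse of \<open>rescale S\<close>, so that the coefficients prescribed for
    \<open>f\<close> become the samples of \<open>invF g\<close>.\<close>
  define g where "g \<xi> = ?c * f (?c * \<xi>)" for \<xi>
  have [measurable]: "f \<in> borel_measurable borel" by (rule band_measurable[OF f(1)])
  have "integrable lborel (\<lambda>\<xi>. (norm (f (0 + ?c * \<xi>)))\<^sup>2)"
    using c by (subst lborel_integrable_real_affine_iff) (auto simp: band_square_integrable[OF f(1)])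
  moreover have "f (?c * \<xi>) = 0" if "\<bar>\<xi>\<bar> > 1 / (2 * S)" for \<xi>
    using that S by (intro band_zero[OF f(1)]) (simp add: abs_mult field_simps)
  ultimately have "band (1 / (2 * S)) (\<lambda>\<xi>. f (?c * \<xi>))"
    by (simp add: band_def)
  then have g: "band (1 / (2 * S)) g"
    unfolding g_def[abs_def] by (rule band_cmult)
  have "?c * (x / ?c) = x" for x using S by simp
  then have "rescale S g x = f x" for x
    unfolding rescale_def g_def using c by (metis nonzero_mult_div_cancel_left of_real_eq_0_iff less_irrefl)
  then have "rescale S g = f" by blast
  then have gx: "invF g (of_int n * S) = complex_of_real (x n)" for n
    using fcoeff_rescale[OF S g, of n] f(2)[of n] by simp
  obtain h where "band (1 / (2 * S)) h" "herm h" "\<And>t. invF h t = complex_of_real (Re (invF g t))"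
    using hermitian_part[OF g] by blast
  then show ?thesis using gx by (intro that[of h]) auto
qed

text \<open>\<open>has_dtft\<close> constrains \<open>Y\<close> only on [-pi, pi]. Extending it by
  zero gives an element of \<open>band pi\<close>, to which the Fourier series results on the line
  apply.\<close>

lemma has_dtft_imp_fcoeff:
  assumes "has_dtft y Y"
  obtains f where "band pi f" "\<And>n. fcoeff f n = complex_of_real (y n)" "\<And>\<theta>. \<bar>\<theta>\<bar> \<le> pi \<Longrightarrow> f \<theta> = Y \<theta>"
proof -
  let ?M = "restrict_space lborel {-pi..pi}"
  define f where "f = trunc pi Y"
  have fY: "f \<theta> = Y \<theta>" if "\<bar>\<theta>\<bar> \<le> pi" for \<theta>
    using that by (auto simp: f_def trunc_def indicator_def)
  have f0: "f \<theta> = 0" if "\<bar>\<theta>\<bar> > pi" for \<theta>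
    using that by (auto simp: f_def trunc_def indicator_def)
  have sY: "Y \<in> borel_measurable ?M" "integrable ?M (\<lambda>t. (norm (Y t))\<^sup>2)"
    and lim: "tendsto_L2 ?M (\<lambda>N \<theta>. \<Sum>n\<in>{- int N..int N}. complex_of_real (y n) * exp (- (\<theta> * real_of_int n) * \<i>)) Y sequentially"
    using assms by (auto simp: has_dtft_def square_integrable_def)
  have "f = (\<lambda>x. indicator {-pi..pi} x *\<^sub>R Y x)"
    by (auto simp: f_def trunc_def indicator_def)
  with sY(1) have fm: "f \<in> borel_measurable lborel"
    by (simp add: borel_measurable_restrict_space_iff)
  have "(\<lambda>x. (norm (f x))\<^sup>2) = (\<lambda>x. indicator {-pi..pi} x *\<^sub>R (norm (Y x))\<^sup>2)"
    by (auto simp: f_def trunc_def indicator_def)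
  with sY(2) have "integrable lborel (\<lambda>x. (norm (f x))\<^sup>2)"
    by (simp add: integrable_restrict_space)
  with fm f0 have f: "band pi f" by (simp add: band_def)
  have "(\<integral>\<^sup>+\<theta>. ennreal ((norm ((\<Sum>n\<in>{- int N..int N}. complex_of_real (y n) * exp (- (\<theta> * real_of_int n) * \<i>)) - Y \<theta>))\<^sup>2) \<partial>?M)
      = ennreal (sq_norm (\<lambda>x. fsum {- int N..int N} (\<lambda>n. complex_of_real (y n)) x - f x))" for N
  proof -
    have "(\<integral>\<^sup>+\<theta>. ennreal ((norm ((\<Sum>n\<in>{- int N..int N}. complex_of_real (y n) * exp (- (\<theta> * real_of_int n) * \<i>)) - Y \<theta>))\<^sup>2) \<partial>?M)
      = (\<integral>\<^sup>+\<theta>. ennreal ((norm (fsum {- int N..int N} (\<lambda>n. complex_of_real (y n)) \<theta> - f \<theta>))\<^sup>2) \<partial>lborel)"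
      by (subst nn_integral_restrict_space, simp, intro nn_integral_cong)
        (auto simp: fsum_def f_def trunc_def indicator_def cis_conv_exp mult_ac)
    then show ?thesis
      by (simp add: nn_integral_eq_sq_norm[OF band_imp_square_integrable[OF band_diff[OF band_fsum f]]])
  qed
  with lim have "(\<lambda>N. ennreal (sq_norm (\<lambda>x. fsum {- int N..int N} (\<lambda>n. complex_of_real (y n)) x - f x))) \<longlonglongrightarrow> ennreal 0"
    by (simp add: tendsto_L2_def)
  then have "(\<lambda>N. sq_norm (\<lambda>x. fsum {- int N..int N} (\<lambda>n. complex_of_real (y n)) x - f x)) \<longlonglongrightarrow> 0"
    by (subst (asm) tendsto_ennreal_iff) (auto simp: sq_norm_nonneg)
  then have "\<And>n. fcoeff f n = complex_of_real (y n)"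
    by (rule fcoeff_L2_limit[OF f])
  with f fY show ?thesis using that by blast
qed

lemma fcoeff_imp_has_dtft:
  assumes f: "band pi f" and y: "\<And>n. fcoeff f n = complex_of_real (y n)"
  shows "has_dtft y f"
proof -
  let ?M = "restrict_space lborel {-pi..pi}"
  have yc: "fcoeff f = (\<lambda>n. complex_of_real (y n))" using y by auto
  have "y \<in> ell2"
    using parseval[OF f] by (auto simp: ell2_def y summable_on_def)
  moreover have "square_integrable ?M f"
  proof -
    have [measurable]: "f \<in> borel_measurable borel" by (rule band_measurable[OF f])
    have "f \<in> borel_measurable ?M" by (simp add: measurable_restrict_space1)
    moreover have "(\<lambda>x. indicator {-pi..pi} x *\<^sub>R (norm (f x))\<^sup>2) = (\<lambda>x. (norm (f x))\<^sup>2)"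
    proof
      fix x show "indicator {-pi..pi} x *\<^sub>R (norm (f x))\<^sup>2 = (norm (f x))\<^sup>2"
        using band_zero[OF f, of x] by (cases "\<bar>x\<bar> > pi") (auto simp: indicator_def)
    qed
    ultimately show ?thesis
      using band_square_integrable[OF f] by (simp add: square_integrable_def integrable_restrict_space)
  qed
  moreover have "tendsto_L2 ?M (\<lambda>N \<theta>. \<Sum>n\<in>{- int N..int N}. complex_of_real (y n) * exp (- (\<theta> * real_of_int n) * \<i>)) f sequentially"
  proof -
    have "(\<integral>\<^sup>+\<theta>. ennreal ((norm ((\<Sum>n\<in>{- int N..int N}. complex_of_real (y n) * exp (- (\<theta> * real_of_int n) * \<i>)) - f \<theta>))\<^sup>2) \<partial>?M)
        = ennreal (sq_norm (\<lambda>x. fsum {- int N..int N} (fcoeff f) x - f x))" for N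
    proof -
      have "ennreal ((norm ((\<Sum>n\<in>{- int N..int N}. complex_of_real (y n) * exp (- (\<theta> * real_of_int n) * \<i>)) - f \<theta>))\<^sup>2)
          * indicator {-pi..pi} \<theta> = ennreal ((norm (fsum {- int N..int N} (fcoeff f) \<theta> - f \<theta>))\<^sup>2)" for \<theta>
        using band_zero[OF f, of \<theta>]
        by (cases "\<bar>\<theta>\<bar> > pi") (auto simp: yc fsum_def indicator_def cis_conv_exp mult_ac)
      then show ?thesis
        by (simp add: nn_integral_restrict_space
            flip: nn_integral_eq_sq_norm[OF band_imp_square_integrable[OF band_diff[OF band_fsum f]]])
    qed
    moreover have "(\<lambda>N. ennreal (sq_norm (\<lambda>x. fsum {- int N..int N} (fcoeff f) x - f x))) \<longlonglongrightarrow> ennreal 0"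
      by (intro tendsto_ennrealI fourier_series_L2 f)
    ultimately show ?thesis by (simp add: tendsto_L2_def)
  qed
  ultimately show ?thesis by (simp add: has_dtft_def)
qed

lemma band_trunc_band: "band A p \<Longrightarrow> band A (trunc b p)"
  by (rule band_cong_support[OF band_trunc[OF band_imp_square_integrable]]) (auto simp: trunc_eq_if band_zero)

lemma herm_trunc: "herm p \<Longrightarrow> herm (trunc b p)"
  by (auto simp: herm_def trunc_def indicator_def)

text \<open>The angle c pi per sample is the frequency c/(2S), so filtering the sequence truncates
  its spectrum. For uniqueness, a competing decomposition has the same constant and the same
  square-summable part; its transform then agrees almost everywhere with \<open>f\<close>, and the
  filtered coefficients coincide.\<close>

lemma LPF_samples:
  assumes S: "S > 0" and p: "band (1 / (2 * S)) p" "herm p"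
  shows "LPF c (\<lambda>n. k + Re (invF p (of_int n * S)))
       = (\<lambda>n. k + Re (invF (trunc (c / (2 * S)) p) (of_int n * S)))"
  unfolding LPF_def
proof (rule the_equality)
  let ?x = "\<lambda>n. Re (invF p (of_int n * S))"
  let ?q = "trunc (c / (2 * S)) p"
  let ?y = "\<lambda>n. Re (invF ?q (of_int n * S))"
  \<comment> \<open>The factor 2 pi cancels the one in \<open>fcoeff_rescale\<close>, so that
    \<open>f\<close> is exactly the discrete-time Fourier transform of the samples.\<close>
  define f where "f \<theta> = 2 * pi * rescale S p \<theta>" for \<theta>
  have q: "band (1 / (2 * S)) ?q" "herm ?q" using p by (auto intro: band_trunc_band herm_trunc)
  have f: "band pi f" unfolding f_def[abs_def] by (intro band_cmult band_rescale[OF S p(1)])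
  have fc: "fcoeff (\<lambda>\<theta>. z * g \<theta>) n = z * fcoeff g n" for z g n
    by (simp add: fcoeff_def mult.assoc)
  have fx: "fcoeff f n = complex_of_real (?x n)" for n
    by (simp add: f_def[abs_def] fc fcoeff_rescale[OF S p(1)] invF_herm[OF p(2)])
  have lf: "trunc (c * pi) f = (\<lambda>\<theta>. 2 * pi * rescale S ?q \<theta>)"
  proof
    fix \<theta>
    have "\<bar>\<theta>\<bar> \<le> c * pi \<longleftrightarrow> \<bar>\<theta> / (2 * pi * S)\<bar> \<le> c / (2 * S)"
      using S by (simp add: abs_mult field_simps)
    then show "trunc (c * pi) f \<theta> = 2 * pi * rescale S ?q \<theta>"
      by (simp add: trunc_eq_if f_def rescale_def)
  qed
  have blf: "band pi (trunc (c * pi) f)" by (rule band_trunc_band[OF f])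
  have fy: "fcoeff (trunc (c * pi) f) n = complex_of_real (?y n)" for n
    by (simp add: lf fc fcoeff_rescale[OF S q(1)] invF_herm[OF q(2)])
  have eqlp: "(\<lambda>\<theta>. indicator {\<theta>. \<bar>\<theta>\<bar> \<le> c * pi} \<theta> * g \<theta>) = trunc (c * pi) g" for g
    by (auto simp: trunc_eq_if)
  show "\<exists>k' x0 y0 X. (\<lambda>n. k + ?x n) = (\<lambda>n. k' + x0 n) \<and> (\<lambda>n. k + ?y n) = (\<lambda>n. k' + y0 n) \<and>
     has_dtft x0 X \<and> has_dtft y0 (\<lambda>\<theta>. indicator {\<theta>. \<bar>\<theta>\<bar> \<le> c * pi} \<theta> * X \<theta>)"
    unfolding eqlp
    using fcoeff_imp_has_dtft[of f ?x, OF f fx] fcoeff_imp_has_dtft[of _ ?y, OF blf fy]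
    by (intro exI[of _ k] exI conjI) (rule refl, rule refl)
  fix y assume "\<exists>k' x0 y0 X. (\<lambda>n. k + ?x n) = (\<lambda>n. k' + x0 n) \<and> y = (\<lambda>n. k' + y0 n) \<and>
     has_dtft x0 X \<and> has_dtft y0 (\<lambda>\<theta>. indicator {\<theta>. \<bar>\<theta>\<bar> \<le> c * pi} \<theta> * X \<theta>)"
  then obtain k' x0 y0 X where xk: "\<And>n. k + ?x n = k' + x0 n" and yk: "y = (\<lambda>n. k' + y0 n)"
    and X: "has_dtft x0 X" and Y: "has_dtft y0 (trunc (c * pi) X)"
    unfolding eqlp by metis
  have "x0 \<in> ell2" using X by (simp add: has_dtft_def)
  note * = ell2_plus_const_unique[OF samples_in_ell2[OF S p] this xk]
  obtain f1 where f1: "band pi f1" "\<And>n. fcoeff f1 n = complex_of_real (x0 n)" "\<And>\<theta>. \<bar>\<theta>\<bar> \<le> pi \<Longrightarrow> f1 \<theta> = X \<theta>"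
    using has_dtft_imp_fcoeff[OF X] by blast
  obtain f2 where f2: "band pi f2" "\<And>n. fcoeff f2 n = complex_of_real (y0 n)"
    "\<And>\<theta>. \<bar>\<theta>\<bar> \<le> pi \<Longrightarrow> f2 \<theta> = trunc (c * pi) X \<theta>"
    using has_dtft_imp_fcoeff[OF Y] by blast
  \<comment> \<open>Inside the period both sides are given by \<open>X\<close>; outside it
    \<open>f1\<close> and \<open>f2\<close> vanish.\<close>
  have f21: "f2 \<theta> = trunc (c * pi) f1 \<theta>" for \<theta>
    using f1(3)[of \<theta>] f2(3)[of \<theta>] band_zero[OF f1(1), of \<theta>] band_zero[OF f2(1), of \<theta>]
    by (cases "\<bar>\<theta>\<bar> \<le> pi") (auto simp: trunc_def)
  have "AE \<theta> in lborel. f1 \<theta> = f \<theta>"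
    using fx f1(2) *(2) by (intro fcoeff_eq_imp_AE_eq f f1) (simp add: fun_eq_iff)
  then have ae: "AE \<theta> in lborel. f2 \<theta> = trunc (c * pi) f \<theta>"
    by eventually_elim (simp add: f21 trunc_def)
  have [measurable]: "f2 \<in> borel_measurable borel" "trunc (c * pi) f \<in> borel_measurable borel"
    using band_measurable f2(1) blf by blast+
  have "fcoeff f2 n = fcoeff (trunc (c * pi) f) n" for n
    using ae by (intro fcoeff_cong_AE) auto
  then have "y0 n = ?y n" for n
    using f2(2)[of n] fy[of n] by (metis of_real_eq_iff)
  then show "y = (\<lambda>n. k + ?y n)" using yk *(1) by simp
qed

section \<open>Spectra of polynomials and aliasing\<close>

definition conv :: "(real \<Rightarrow> complex) \<Rightarrow> (real \<Rightarrow> complex) \<Rightarrow> real \<Rightarrow> complex" where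
  "conv f g x = (LINT y|lborel. f y * g (x - y))"

text \<open>Multiplying signals convolves spectra, and the supports add. Square integrability
  follows from a uniform bound on the bounded support, and the product formula from Fubini and
  translation invariance.\<close>

lemma
  assumes f: "band A f" and g: "band B g"
  shows band_conv: "band (A + B) (conv f g)"
    and invF_conv: "invF (conv f g) t = invF f t * invF g t"
proof -
  have [measurable]: "f \<in> borel_measurable borel" "g \<in> borel_measurable borel"
    using assms by (auto dest: band_measurable)
  have cm[measurable]: "conv f g \<in> borel_measurable borel"
    unfolding conv_def[abs_def] by measurable
  have shift: "integrable lborel (\<lambda>x. h (x - y))" if "integrable lborel h" for h :: "real \<Rightarrow> complex" and y
    using lborel_integrable_real_affine[OF that, of 1 "- y"] by simp
  let ?k = "\<lambda>y x. f y * g (x - y)"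
  have zero: "conv f g x = 0" if "\<bar>x\<bar> > A + B" for x
  proof -
    have "f y * g (x - y) = 0" for y
      using band_zero[OF f, of y] band_zero[OF g, of "x - y"] that by (cases "\<bar>y\<bar> > A") auto
    then have "(\<lambda>y. f y * g (x - y)) = (\<lambda>y. 0)" by blast
    then show ?thesis by (simp add: conv_def)
  qed
  \<comment> \<open>A bound from the elementary inequality u v <= u^2 + v^2 under the integral; any
    constant independent of \<open>x\<close> would do.\<close>
  define C where "C = sq_norm f + sq_norm g"
  have bound: "norm (conv f g x) \<le> C" for x
  proof -
    have g2: "integrable lborel (\<lambda>y. (norm (g (x + (-1) * y)))\<^sup>2)"
      using band_square_integrable[OF g] by (rule lborel_integrable_real_affine) simp
    have g3: "(LINT y|lborel. (norm (g (x + (-1) * y)))\<^sup>2) = sq_norm g"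
      unfolding sq_norm_def by (subst (2) lborel_integral_real_affine[where c = "-1" and t = x]) auto
    have "norm (conv f g x) \<le> (LINT y|lborel. norm (f y * g (x - y)))"
      unfolding conv_def by (rule integral_norm_bound)
    also have "\<dots> \<le> (LINT y|lborel. (norm (f y))\<^sup>2 + (norm (g (x + (-1) * y)))\<^sup>2)"
    proof (rule integral_mono')
      show "integrable lborel (\<lambda>y. (norm (f y))\<^sup>2 + (norm (g (x + (-1) * y)))\<^sup>2)"
        using band_square_integrable[OF f] g2 by simp
      fix y
      have "norm (f y * g (x - y)) \<le> (norm (f y))\<^sup>2 + (norm (g (x - y)))\<^sup>2"
        unfolding norm_mult by (rule mult_le_sum_power2) auto
      then show "norm (f y * g (x - y)) \<le> (norm (f y))\<^sup>2 + (norm (g (x + (-1) * y)))\<^sup>2"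
        by simp
    qed simp
    also have "\<dots> = C"
      using band_square_integrable[OF f] g2 g3 by (simp add: C_def sq_norm_def)
    finally show ?thesis .
  qed
  have "integrable lborel (\<lambda>x. (norm (conv f g x))\<^sup>2)"
  proof (rule Bochner_Integration.integrable_bound)
    show "integrable lborel (\<lambda>x. C\<^sup>2 * indicator {-(A + B)..A + B} x)"
      by (intro integrable_mult_right integrable_indicator_Icc)
    have "norm ((norm (conv f g x))\<^sup>2) \<le> norm (C\<^sup>2 * indicator {-(A + B)..A + B} x)" for x
      using zero[of x] power_mono[OF bound[of x], of 2]
      by (cases "\<bar>x\<bar> > A + B") (auto simp: indicator_def)
    then show "AE x in lborel. norm ((norm (conv f g x))\<^sup>2) \<le> norm (C\<^sup>2 * indicator {-(A + B)..A + B} x)"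
      by (intro AE_I2)
  qed simp
  with zero show b: "band (A + B) (conv f g)"
    by (simp add: band_def)
  let ?e = "\<lambda>x. cis (2 * pi * x * t)"
  have int: "integrable (lborel \<Otimes>\<^sub>M lborel) (\<lambda>(y, x). ?k y x * ?e x)"
  proof (rule lborel_pair.Fubini_integrable)
    show "(\<lambda>(y, x). ?k y x * ?e x) \<in> borel_measurable (lborel \<Otimes>\<^sub>M lborel)"
      by measurable
    have "(LINT x|lborel. norm (g (x - y))) = (LINT x|lborel. norm (g x))" for y
      by (subst (2) lborel_integral_real_affine[where c = 1 and t = "- y"]) auto
    then show "integrable lborel (\<lambda>y. LINT x|lborel. norm (case (y, x) of (y, x) \<Rightarrow> ?k y x * ?e x))"
      using band_integrable[OF f] by (simp add: norm_mult)
    have "integrable lborel (\<lambda>x. ?k y x * ?e x)" for y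
    proof (rule Bochner_Integration.integrable_bound)
      show "integrable lborel (\<lambda>x. f y * g (x - y))"
        by (intro integrable_mult_right shift band_integrable[OF g])
    qed (auto simp: norm_mult)
    then show "AE y in lborel. integrable lborel (\<lambda>x. case (y, x) of (y, x) \<Rightarrow> ?k y x * ?e x)"
      by simp
  qed
  have "invF (conv f g) t = (LINT x|lborel. LINT y|lborel. ?k y x * ?e x)"
    by (simp add: invF_def conv_def)
  also have "\<dots> = (LINT y|lborel. LINT x|lborel. ?k y x * ?e x)"
    using lborel_pair.Fubini_integral[OF int] by simp
  also have "\<dots> = (LINT y|lborel. (f y * ?e y) * invF g t)"
  proof (rule Bochner_Integration.integral_cong[OF refl])
    fix y
    have "(LINT x|lborel. ?k y x * ?e x) = \<bar>1\<bar> *\<^sub>R (LINT x|lborel. ?k y (y + 1 * x) * ?e (y + 1 * x))"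
      by (rule lborel_integral_real_affine) simp
    also have "\<dots> = (LINT x|lborel. (f y * ?e y) * (g x * ?e x))"
      by (simp add: distrib_left distrib_right cis_mult[symmetric] mult_ac)
    also have "\<dots> = (f y * ?e y) * invF g t"
      unfolding invF_def by (rule integral_mult_right_zero)
    finally show "(LINT x|lborel. ?k y x * ?e x) = (f y * ?e y) * invF g t" .
  qed
  also have "\<dots> = invF f t * invF g t"
    unfolding invF_def by (rule integral_mult_left_zero)
  finally show "invF (conv f g) t = invF f t * invF g t" .
qed

text \<open>The induction starts at exponent 1, since the constant function 1 is not
  square-integrable and so is no \<open>invF\<close> of a spectrum in a band.\<close>

lemma power_spectrum:
  assumes g: "band A g" and "i \<ge> 1"
  obtains h where "band (real i * A) h" "\<And>t. invF h t = invF g t ^ i"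
proof -
  from \<open>i \<ge> 1\<close> have "\<exists>h. band (real i * A) h \<and> (\<forall>t. invF h t = invF g t ^ i)"
  proof (induction i rule: dec_induct)
    case base
    then show ?case using g by auto
  next
    case (step i)
    then obtain h where h: "band (real i * A) h" "\<And>t. invF h t = invF g t ^ i" by blast
    then show ?case
      using band_conv[OF g h(1)] invF_conv[OF g h(1)]
      by (intro exI[of _ "conv g h"]) (simp add: distrib_right)
  qed
  then show ?thesis using that by blast
qed

text \<open>The term \<open>a 0\<close> stays outside for the same reason that powers start at 1.
  Nonnegativity of \<open>A\<close> makes the bands of the lower powers lie within that of degree
  \<open>d\<close>.\<close>

lemma polynomial_spectrum:
  fixes a :: "nat \<Rightarrow> real"
  assumes g: "band A g" "herm g" and A: "A \<ge> 0"
  obtains h where "band (real d * A) h" "herm h"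
    "\<And>t. (\<Sum>i\<le>d. a i * Re (invF g t) ^ i) = a 0 + Re (invF h t)"
proof -
  have "\<exists>h. band (real d * A) h \<and> (\<forall>t. invF h t = (\<Sum>i\<in>{1..d}. a i * invF g t ^ i))"
  proof (induction d)
    case 0
    then show ?case by (intro exI[of _ "\<lambda>x. 0"]) (simp add: band_null invF_def)
  next
    case (Suc d)
    then obtain h where h: "band (real d * A) h" "\<And>t. invF h t = (\<Sum>i\<in>{1..d}. a i * invF g t ^ i)" by blast
    have h': "band (real (Suc d) * A) h" using h(1) by (rule band_mono) (simp add: A mult_right_mono)
    obtain k where k: "band (real (Suc d) * A) k" "\<And>t. invF k t = invF g t ^ Suc d"
      using power_spectrum[OF g(1), of "Suc d"] by auto
    have k': "band (real (Suc d) * A) (\<lambda>x. complex_of_real (a (Suc d)) * k x)" by (rule band_cmult[OF k(1)])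
    have "invF (\<lambda>x. h x + complex_of_real (a (Suc d)) * k x) t = (\<Sum>i\<in>{1..Suc d}. a i * invF g t ^ i)" for t
      by (simp add: invF_add[OF h' k'] invF_cmult h(2) k(2))
    with band_add[OF h' k'] show ?case by blast
  qed
  then obtain h0 where h0: "band (real d * A) h0" "\<And>t. invF h0 t = (\<Sum>i\<in>{1..d}. a i * invF g t ^ i)" by blast
  \<comment> \<open>The values of \<open>invF h0\<close> are already real, so passing to the
    Hermitian part leaves them unchanged.\<close>
  obtain h where h: "band (real d * A) h" "herm h" "\<And>t. invF h t = complex_of_real (Re (invF h0 t))"
    using hermitian_part[OF h0(1)] by blast
  have "(\<Sum>i\<le>d. a i * Re (invF g t) ^ i) = a 0 + Re (invF h t)" for t
  proof -
    have "invF h0 t = (\<Sum>i\<in>{1..d}. complex_of_real (a i) * complex_of_real (Re (invF g t)) ^ i)"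
      using h0(2)[of t] invF_herm[OF g(2), of t] by simp
    also have "\<dots> = complex_of_real (\<Sum>i\<in>{1..d}. a i * Re (invF g t) ^ i)"
      by simp
    finally have "Re (invF h t) = (\<Sum>i\<in>{1..d}. a i * Re (invF g t) ^ i)"
      by (simp only: h(3) Re_complex_of_real)
    moreover have "{..d} = insert 0 {1..d}" by auto
    ultimately show ?thesis by simp
  qed
  with h(1,2) show ?thesis by (rule that)
qed

text \<open>The periodization of \<open>h\<close> with period \<open>2 * b\<close>, restricted to one period. Only three terms are
  needed, since the support of \<open>h\<close> will lie in \<open>[-3 * b, 3 * b]\<close>.\<close>
definition alias_sum :: "real \<Rightarrow> (real \<Rightarrow> complex) \<Rightarrow> real \<Rightarrow> complex" where
  "alias_sum b h x = indicator {-b<..<b} x * (h x + h (x + 2 * b) + h (x - 2 * b))"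

lemma band_shift:
  assumes h: "band A h"
  shows "band (A + \<bar>c\<bar>) (\<lambda>x. h (x + c))"
proof -
  have [measurable]: "h \<in> borel_measurable borel" by (rule band_measurable[OF h])
  have "integrable lborel (\<lambda>x. (norm (h (c + 1 * x)))\<^sup>2)"
    using band_square_integrable[OF h] by (rule lborel_integrable_real_affine) simp
  moreover have "h (x + c) = 0" if "\<bar>x\<bar> > A + \<bar>c\<bar>" for x
    using that by (intro band_zero[OF h]) linarith
  ultimately show ?thesis by (simp add: band_def add.commute)
qed

text \<open>On the grid with spacing 1/(2b) the characters have period 2b in the frequency. Hence
  the three translated pieces can be moved back to cover [-3b, 3b] without altering the samples. The
  symmetric cell keeps the sum Hermitian.\<close>

lemma
  assumes h: "band A h" and b: "b > 0"
  shows band_alias_sum: "band b (alias_sum b h)"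
    and herm_alias_sum: "herm h \<Longrightarrow> herm (alias_sum b h)"
    and invF_alias_sum: "A \<le> 3 * b \<Longrightarrow> invF (alias_sum b h) (of_int n / (2 * b)) = invF h (of_int n / (2 * b))"
proof -
  have [measurable]: "h \<in> borel_measurable borel" by (rule band_measurable[OF h])
  have "band (A + 2 * b) h" "band (A + 2 * b) (\<lambda>x. h (x + 2 * b))" "band (A + 2 * b) (\<lambda>x. h (x - 2 * b))"
    using band_mono[OF h, of "A + 2 * b"] band_shift[OF h, of "2 * b"] band_shift[OF h, of "- (2 * b)"] b by auto
  then have "band (A + 2 * b) (\<lambda>x. indicator {-b<..<b} x * (h x + h (x + 2 * b) + h (x - 2 * b)))"
    by (intro band_mult_bounded band_add) (auto simp: indicator_def)
  then have "band (A + 2 * b) (alias_sum b h)"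
    by (simp add: alias_sum_def[abs_def])
  then show "band b (alias_sum b h)"
    by (rule band_cong_support) (auto simp: alias_sum_def indicator_def)
  show "herm (alias_sum b h)" if "herm h"
  proof -
    have hh: "h (- x) = cnj (h x)" for x using that by (simp add: herm_def)
    have "h (- x + 2 * b) = cnj (h (x - 2 * b))" "h (- x - 2 * b) = cnj (h (x + 2 * b))" for x
      using hh[of "x - 2 * b"] hh[of "x + 2 * b"] by (simp_all add: algebra_simps)
    then show ?thesis
      by (auto simp: herm_def alias_sum_def indicator_def hh)
  qed
  show "invF (alias_sum b h) (of_int n / (2 * b)) = invF h (of_int n / (2 * b))" if A: "A \<le> 3 * b"
  proof -
    let ?t = "of_int n / (2 * b)"
    let ?e = "\<lambda>x. cis (2 * pi * x * ?t)"
    have per: "?e (x + 2 * b) = ?e x" "?e (x + - (2 * b)) = ?e x" for x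
    proof -
      have "2 * pi * (x + 2 * b) * ?t = 2 * pi * x * ?t + 2 * pi * of_int n"
        "2 * pi * (x + - (2 * b)) * ?t = 2 * pi * x * ?t - 2 * pi * of_int n"
        using b by (simp_all add: field_simps)
      then show "?e (x + 2 * b) = ?e x" "?e (x + - (2 * b)) = ?e x"
        by (simp_all only:) (simp_all add: complex_eq_iff cos_add sin_add cos_diff sin_diff)
    qed
    let ?w = "\<lambda>x. h x * ?e x"
    have iw: "integrable lborel ?w" by (rule invF_integrable[OF h])
    have piece: "integrable lborel (\<lambda>x. indicator {l<..<u} x * ?w x)" for l u
    proof -
      have "(\<lambda>x. indicator {l<..<u} x * ?w x) = (\<lambda>x. indicator {l<..<u} x *\<^sub>R ?w x)"
        by (auto simp: indicator_def)
      then show ?thesis using integrable_mult_indicator[OF _ iw, of "{l<..<u}"] by simp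
    qed
    have shifted: "(LINT x|lborel. indicator {-b<..<b} x * ?w (x + c)) = (LINT x|lborel. indicator {c - b<..<c + b} x * ?w x)"
        "integrable lborel (\<lambda>x. indicator {-b<..<b} x * ?w (x + c))" for c
    proof -
      have eq: "(\<lambda>x. indicator {c - b<..<c + b} (c + 1 * x) * ?w (c + 1 * x)) = (\<lambda>x. indicator {-b<..<b} x * ?w (x + c))"
        by (auto simp: indicator_def add.commute)
      show "(LINT x|lborel. indicator {-b<..<b} x * ?w (x + c)) = (LINT x|lborel. indicator {c - b<..<c + b} x * ?w x)"
        by (subst (2) lborel_integral_real_affine[where c = 1 and t = c]) (simp_all only: eq, auto)
      show "integrable lborel (\<lambda>x. indicator {-b<..<b} x * ?w (x + c))"
        unfolding eq[symmetric] using piece by (rule lborel_integrable_real_affine) simp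
    qed
    have "invF (alias_sum b h) ?t = (LINT x|lborel. indicator {-b<..<b} x * ?w (x + 0)
        + indicator {-b<..<b} x * ?w (x + 2 * b) + indicator {-b<..<b} x * ?w (x + (- (2 * b))))"
      unfolding invF_def alias_sum_def
      by (intro Bochner_Integration.integral_cong refl)
        (simp only: per add_0_right diff_conv_add_uminus, simp only: distrib_left distrib_right mult.assoc)
    also have "\<dots> = (LINT x|lborel. indicator {-b<..<b} x * ?w x) + (LINT x|lborel. indicator {b<..<3 * b} x * ?w x)
        + (LINT x|lborel. indicator {-(3 * b)<..<-b} x * ?w x)"
      using shifted(2)[of 0] shifted(2)[of "2 * b"] shifted(2)[of "- (2 * b)"]
        shifted(1)[of 0] shifted(1)[of "2 * b"] shifted(1)[of "- (2 * b)"] by simp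
    also have "\<dots> = (LINT x|lborel. indicator {-b<..<b} x * ?w x + indicator {b<..<3 * b} x * ?w x + indicator {-(3 * b)<..<-b} x * ?w x)"
      using piece by simp
    also have "\<dots> = (LINT x|lborel. ?w x)"
    proof (rule integral_cong_AE)
      \<comment> \<open>The open cells miss exactly these four endpoints of the tiling.\<close>
      have "AE x in lborel. x \<notin> {b, -b, 3 * b, - (3 * b)}"
        by (intro AE_not_in finite_imp_null_set_lborel) auto
      then show "AE x in lborel. indicator {-b<..<b} x * ?w x + indicator {b<..<3 * b} x * ?w x + indicator {-(3 * b)<..<-b} x * ?w x = ?w x"
      proof eventually_elim
        case (elim x)
        show ?case
        proof (cases "\<bar>x\<bar> > A")
          case True
          then show ?thesis by (simp add: band_zero[OF h])
        next
          case False
          with A have "\<bar>x\<bar> \<le> 3 * b" by simp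
          then consider "x \<in> {-b<..<b}" | "x \<in> {b<..<3 * b}" | "x \<in> {-(3 * b)<..<-b}"
            using elim by fastforce
          then show ?thesis using b by cases (auto simp: indicator_def)
        qed
      qed
    qed auto
    finally show ?thesis by (simp add: invF_def)
  qed
qed

text \<open>The supports of the two translates reach no closer to the origin than 2b - A.\<close>

lemma alias_sum_eq:
  assumes h: "band A h" and "\<bar>x\<bar> < b" and "\<bar>x\<bar> < 2 * b - A"
  shows "alias_sum b h x = h x"
proof -
  have "h (x + 2 * b) = 0" "h (x - 2 * b) = 0"
    using assms by (auto intro!: band_zero[OF h])
  then show ?thesis using assms(2) by (auto simp: alias_sum_def indicator_def)
qed

section \<open>The stages of the activation in terms of spectra\<close>

lemma translate_samples:
  assumes T: "T > 0" and g: "band (1 / (2 * T)) g" "herm g"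
  shows "translate T \<Delta> (\<lambda>n. k + Re (invF g (of_int n * T)))
       = (\<lambda>n. k + Re (invF (\<lambda>x. g x * cis (2 * pi * x * \<Delta>)) (of_int n * T)))"
  unfolding translate_def reconstruct_samples[OF T g] invF_modulate ..

lemma upsample_samples:
  assumes T: "T > 0" and g: "band (1 / (2 * T)) g" "herm g"
  shows "upsample T I (\<lambda>n. k + Re (invF g (of_int n * T))) = (\<lambda>m. k + Re (invF g (of_int m * T / I)))"
  unfolding upsample_def reconstruct_samples[OF T g] ..

text \<open>The output depends only on the low-pass part of the spectrum \<open>h\<close> of the
  polynomial, with no trace of the intermediate grid. The spectrum \<open>h\<close> is a parameter
  so that the lemma can be applied to a modulated pair \<open>g\<close>, \<open>h\<close>.\<close>

lemma alias_free_activation_samples: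
  fixes a :: "nat \<Rightarrow> real"
  assumes T: "T > 0" and d: "d \<ge> 1" and g: "band (1 / (2 * T)) g" "herm g"
    and h: "band (real d / (2 * T)) h" "herm h"
    and poly: "\<And>t. (\<Sum>i\<le>d. a i * Re (invF g t) ^ i) = a 0 + Re (invF h t)"
  shows "alias_free_activation T d a (\<lambda>n. Re (invF g (of_int n * T)))
       = (\<lambda>n. a 0 + Re (invF (trunc (1 / (2 * T)) h) (of_int n * T)))"
proof -
  define I where "I = (real d + 1) / 2"
  define S where "S = T / I"
  \<comment> \<open>Half the sampling rate of the upsampled grid, so that aliases are displaced by
    multiples of 2b = I/T.\<close>
  define b where "b = 1 / (2 * S)"
  have I: "I \<ge> 1" using d by (simp add: I_def)
  have S: "S > 0" using T I by (simp add: S_def)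
  have b: "b > 0" using S by (simp add: b_def)
  have b2: "2 * b = (real d + 1) / (2 * T)" using T by (simp add: b_def S_def I_def field_simps)
  have cut: "1 / I / (2 * S) = 1 / (2 * T)" using T I by (simp add: S_def)
  \<comment> \<open>The identity that fixes the upsampling factor: the edge of the nearest alias is
    the cutoff of the filter.\<close>
  have T1: "1 / (2 * T) = 2 * b - real d / (2 * T)"
    unfolding b2 by (simp add: add_divide_distrib)
  \<comment> \<open>This is where \<open>d\<close> being at least 1 enters: the original band fits
    within that of the upsampled grid.\<close>
  have T2: "1 / (2 * T) \<le> b"
  proof -
    have "2 * (1 / (2 * T)) \<le> (real d + 1) / (2 * T)" using T d by (simp add: field_simps)
    then show ?thesis using b2 by simp
  qed
  have T3: "real d / (2 * T) \<le> 3 * b"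
  proof -
    have "1 / (2 * T) \<ge> 0" using T by simp
    then show ?thesis using T1 b by linarith
  qed
  have up: "upsample T I (\<lambda>n. Re (invF g (of_int n * T))) = (\<lambda>m. Re (invF g (of_int m * S)))"
    using upsample_samples[OF T g, of I 0] by (simp add: S_def)
  let ?p = "alias_sum b h"
  have p: "band (1 / (2 * S)) ?p" "herm ?p"
    using band_alias_sum[OF h(1) b] herm_alias_sum[OF h(1) b h(2)] by (simp_all add: b_def)
  have nS: "of_int n * S = of_int n / (2 * b)" for n
    using S by (simp add: b_def)
  have poly_p: "poly_pointwise d a (\<lambda>m. Re (invF g (of_int m * S))) = (\<lambda>m. a 0 + Re (invF ?p (of_int m * S)))"
    by (simp add: poly_pointwise_def poly nS invF_alias_sum[OF h(1) b T3])
  \<comment> \<open>An alias may touch the closed passband at its two edge frequencies; these form a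
    null set and do not affect \<open>invF\<close>.\<close>
  have lp: "invF (trunc (1 / (2 * T)) ?p) = invF (trunc (1 / (2 * T)) h)"
  proof (rule invF_cong_AE)
    have "AE x in lborel. x \<notin> {1 / (2 * T), - (1 / (2 * T))}"
      by (intro AE_not_in finite_imp_null_set_lborel) auto
    then show "AE x in lborel. trunc (1 / (2 * T)) ?p x = trunc (1 / (2 * T)) h x"
    proof eventually_elim
      case (elim x)
      show ?case
      proof (cases "\<bar>x\<bar> \<le> 1 / (2 * T)")
        case True
        with elim have x: "\<bar>x\<bar> < 1 / (2 * T)" by auto
        have "?p x = h x"
          using x T1 T2 by (intro alias_sum_eq[OF h(1)]) linarith+
        then show ?thesis by (simp add: trunc_def)
      qed (simp add: trunc_eq_if)
    qed
  qed (use band_measurable[OF band_trunc_band[OF p(1)]] band_measurable[OF band_trunc_band[OF h(1)]] in auto)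
  have LPF: "LPF (1 / I) (\<lambda>m. a 0 + Re (invF ?p (of_int m * S)))
      = (\<lambda>m. a 0 + Re (invF (trunc (1 / (2 * T)) h) (of_int m * S)))"
    unfolding LPF_samples[OF S p] cut lp ..
  have q: "band (1 / (2 * S)) (trunc (1 / (2 * T)) h)" "herm (trunc (1 / (2 * T)) h)"
    using band_mono[OF band_trunc[OF band_imp_square_integrable[OF h(1)]] T2] herm_trunc[OF h(2)] by (simp_all add: b_def)
  have "reconstruct (T / I) (\<lambda>m. a 0 + Re (invF (trunc (1 / (2 * T)) h) (of_int m * S)))
      = (\<lambda>t. a 0 + Re (invF (trunc (1 / (2 * T)) h) t))"
    unfolding S_def[symmetric] by (rule reconstruct_samples[OF S q])
  then show ?thesis
    unfolding alias_free_activation_def Let_def I_def[symmetric] up poly_p LPF downsample_def by simp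
qed

theorem proposition2:
  fixes T \<Delta> :: real and d :: nat and a :: "nat \<Rightarrow> real" and x :: "int \<Rightarrow> real"
  assumes "T > 0" and "d \<ge> 1" and "x \<in> ell2"
  shows "alias_free_activation T d a (translate T \<Delta> x)
       = translate T \<Delta> (alias_free_activation T d a x)"
proof -
  note T = assms(1) and d = assms(2)
  obtain g where g: "band (1 / (2 * T)) g" "herm g" and x: "x = (\<lambda>n. Re (invF g (of_int n * T)))"
    using ell2_samples[OF T assms(3)] by blast
  \<comment> \<open>The polynomial identity holds at every real time and not just on a grid, so
    replacing \<open>t\<close> by t + \<Delta> shows that the modulated \<open>h\<close> serves the
    modulated \<open>g\<close>.\<close>
  obtain h where h: "band (real d / (2 * T)) h" "herm h"
    and poly: "\<And>t. (\<Sum>i\<le>d. a i * Re (invF g t) ^ i) = a 0 + Re (invF h t)"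
    using polynomial_spectrum[OF g, of d a] T by auto
  let ?mod = "\<lambda>f x. f x * cis (2 * pi * x * \<Delta>)"
  have "translate T \<Delta> x = (\<lambda>n. Re (invF (?mod g) (of_int n * T)))"
    unfolding x using translate_samples[OF T g, of \<Delta> 0] by simp
  moreover have "alias_free_activation T d a (\<lambda>n. Re (invF (?mod g) (of_int n * T)))
      = (\<lambda>n. a 0 + Re (invF (trunc (1 / (2 * T)) (?mod h)) (of_int n * T)))"
    using g h by (intro alias_free_activation_samples T d band_modulate herm_modulate) (simp_all add: invF_modulate poly)
  \<comment> \<open>Filtering and translating are both pointwise multiplications of the spectrum,
    hence they commute.\<close>
  moreover have "trunc (1 / (2 * T)) (?mod h) = ?mod (trunc (1 / (2 * T)) h)"
    by (simp add: trunc_def fun_eq_iff)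
  moreover have "translate T \<Delta> (alias_free_activation T d a x)
      = (\<lambda>n. a 0 + Re (invF (?mod (trunc (1 / (2 * T)) h)) (of_int n * T)))"
    unfolding x alias_free_activation_samples[OF T d g h poly]
    by (rule translate_samples[OF T band_trunc[OF band_imp_square_integrable[OF h(1)]] herm_trunc[OF h(2)]])
  ultimately show ?thesis by simp
qed

end
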